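(* Consider marriage markets $(W,M,\succ_W,\succ_M)$ with full preference lists and $|W|=|M|=n$. Any randomized (or deterministic) algorithm that accesses the input only through Boolean queries, each of which is an arbitrary Boolean function either of the women's profile $\succ_W$ alone or of the men's profile $\succ_M$ alone, requires $\Omega(n^2)$ queries in the worst case to solve any of the following problems: (a) finding a $(1-\varepsilon)$-stable marriage, for fixed $\varepsilon$ with $0\le\varepsilon<\tfrac12$; (b) determining, for a given perfect marriage $\mu$ promised to be either stable or $\varepsilon$-unstable, which is the case, for fixed $\varepsilon$ with $0\le\varepsilon<1$; (c) determining whether a given pair $(w,m)\in W\times M$ is contained in some (respectively, every) stable marriage; (d) finding any $\varepsilon n$ pairs that appear in some (respectively, every) stable marriage, for fixed $\varepsilon$ with $0<\varepsilon\le1$.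
   Context: In a marriage market with full preference lists, $W$ and $M$ are disjoint sets of size $n$, each woman has a total order on $M$ and each man a total order on $W$. A perfect marriage is a bijection between $W$ and $M$, identified with its set of $n$ pairs. A pair $(w,m)$ is blocking for $\mu$ if $w$ prefers $m$ to her spouse in $\mu$ and $m$ prefers $w$ to his spouse in $\mu$; $\mu$ is stable if it has no blocking pair. The divorce distance is $d(\mu,\mu')=n-|\mu\cap\mu'|$, $d(\mu)=\min_{\mu'}d(\mu,\mu')$ over stable perfect marriages $\mu'$; $\mu$ is $(1-\varepsilon)$-stable if $d(\mu)\le\varepsilon n$ and $\varepsilon$-unstable if $d(\mu)>\varepsilon n$. A randomized algorithm must produce a correct output with probability at least $2/3$ on every input; the query count is measured in the worst case over inputs, asymptotically in $n$. *)

theory Defs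
  imports "HOL-Probability.Probability"
begin

text \<open>Women and men are both identified with {0..<n}. A profile assigns to each agent
 a ranking list of the other side (most preferred first); a full preference list is a
 permutation of {0..<n}. Entries for agents outside {0..<n} are fixed to the empty list.\<close>

type_synonym profile = "nat \<Rightarrow> nat list"

definition valid_profile :: "nat \<Rightarrow> profile \<Rightarrow> bool" where
  "valid_profile n p \<longleftrightarrow>
     (\<forall>a<n. distinct (p a) \<and> set (p a) = {..<n}) \<and> (\<forall>a\<ge>n. p a = [])"

fun pos :: "nat \<Rightarrow> nat list \<Rightarrow> nat" where
  "pos x [] = 0"
| "pos x (y # ys) = (if x = y then 0 else Suc (pos x ys))"

definition prefers :: "profile \<Rightarrow> nat \<Rightarrow> nat \<Rightarrow> nat \<Rightarrow> bool" where
  "prefers p a x y \<longleftrightarrow> pos x (p a) < pos y (p a)"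

definition perfect :: "nat \<Rightarrow> (nat \<times> nat) set \<Rightarrow> bool" where
  "perfect n \<mu> \<longleftrightarrow> \<mu> \<subseteq> {..<n} \<times> {..<n}
     \<and> (\<forall>w<n. \<exists>!m. (w, m) \<in> \<mu>) \<and> (\<forall>m<n. \<exists>!w. (w, m) \<in> \<mu>)"

definition husband :: "(nat \<times> nat) set \<Rightarrow> nat \<Rightarrow> nat" where
  "husband \<mu> w = (THE m. (w, m) \<in> \<mu>)"

definition wife :: "(nat \<times> nat) set \<Rightarrow> nat \<Rightarrow> nat" where
  "wife \<mu> m = (THE w. (w, m) \<in> \<mu>)"

definition blocking :: "nat \<Rightarrow> profile \<Rightarrow> profile \<Rightarrow> (nat \<times> nat) set \<Rightarrow> nat \<Rightarrow> nat \<Rightarrow> bool" where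
  "blocking n pW pM \<mu> w m \<longleftrightarrow> w < n \<and> m < n
     \<and> prefers pW w m (husband \<mu> w) \<and> prefers pM m w (wife \<mu> m)"

definition stable :: "nat \<Rightarrow> profile \<Rightarrow> profile \<Rightarrow> (nat \<times> nat) set \<Rightarrow> bool" where
  "stable n pW pM \<mu> \<longleftrightarrow> perfect n \<mu> \<and> (\<forall>w m. \<not> blocking n pW pM \<mu> w m)"

definition divorce_dist :: "nat \<Rightarrow> (nat \<times> nat) set \<Rightarrow> (nat \<times> nat) set \<Rightarrow> nat" where
  "divorce_dist n \<mu> \<mu>' = n - card (\<mu> \<inter> \<mu>')"

definition dist_stable :: "nat \<Rightarrow> profile \<Rightarrow> profile \<Rightarrow> (nat \<times> nat) set \<Rightarrow> nat" where
  "dist_stable n pW pM \<mu> = Min {divorce_dist n \<mu> \<mu>' | \<mu>'. stable n pW pM \<mu>'}"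

definition almost_stable :: "real \<Rightarrow> nat \<Rightarrow> profile \<Rightarrow> profile \<Rightarrow> (nat \<times> nat) set \<Rightarrow> bool" where
  "almost_stable \<epsilon> n pW pM \<mu> \<longleftrightarrow> real (dist_stable n pW pM \<mu>) \<le> \<epsilon> * real n"

definition eps_unstable :: "real \<Rightarrow> nat \<Rightarrow> profile \<Rightarrow> profile \<Rightarrow> (nat \<times> nat) set \<Rightarrow> bool" where
  "eps_unstable \<epsilon> n pW pM \<mu> \<longleftrightarrow> real (dist_stable n pW pM \<mu>) > \<epsilon> * real n"

datatype 'o qtree =
    Leaf 'o
  | QueryW "profile \<Rightarrow> bool" "'o qtree" "'o qtree"
  | QueryM "profile \<Rightarrow> bool" "'o qtree" "'o qtree"

fun run :: "'o qtree \<Rightarrow> profile \<Rightarrow> profile \<Rightarrow> 'o" where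
  "run (Leaf r) pW pM = r"
| "run (QueryW f t1 t2) pW pM = (if f pW then run t1 pW pM else run t2 pW pM)"
| "run (QueryM f t1 t2) pW pM = (if f pM then run t1 pW pM else run t2 pW pM)"

fun queries :: "'o qtree \<Rightarrow> profile \<Rightarrow> profile \<Rightarrow> nat" where
  "queries (Leaf r) pW pM = 0"
| "queries (QueryW f t1 t2) pW pM = Suc (if f pW then queries t1 pW pM else queries t2 pW pM)"
| "queries (QueryM f t1 t2) pW pM = Suc (if f pM then queries t1 pW pM else queries t2 pW pM)"

text \<open>A randomized algorithm for a problem with an explicit (known) parameter x of type 'x
 (e.g. a given marriage or a given pair) is a probability distribution over decision trees
 for each parameter value (deterministic algorithms: point masses).
 Dom x pW pM: x is a legal parameter and the input satisfies the promise.
 R x pW pM o: o is a correct output.\<close>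

definition rand_solves ::
  "nat \<Rightarrow> ('x \<Rightarrow> profile \<Rightarrow> profile \<Rightarrow> bool) \<Rightarrow> ('x \<Rightarrow> profile \<Rightarrow> profile \<Rightarrow> 'o \<Rightarrow> bool)
   \<Rightarrow> ('x \<Rightarrow> 'o qtree pmf) \<Rightarrow> bool" where
  "rand_solves n Dom R A \<longleftrightarrow>
     (\<forall>x pW pM. valid_profile n pW \<and> valid_profile n pM \<and> Dom x pW pM \<longrightarrow>
        measure_pmf.prob (A x) {T. R x pW pM (run T pW pM)} \<ge> 2/3)"

definition query_bounded ::
  "nat \<Rightarrow> ('x \<Rightarrow> profile \<Rightarrow> profile \<Rightarrow> bool) \<Rightarrow> nat \<Rightarrow> ('x \<Rightarrow> 'o qtree pmf) \<Rightarrow> bool" where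
  "query_bounded n Dom q A \<longleftrightarrow>
     (\<forall>x pW pM T. valid_profile n pW \<and> valid_profile n pM \<and> Dom x pW pM
        \<and> T \<in> set_pmf (A x) \<longrightarrow> queries T pW pM \<le> q)"

definition query_lower_bound_sq ::
  "(nat \<Rightarrow> 'x \<Rightarrow> profile \<Rightarrow> profile \<Rightarrow> bool) \<Rightarrow> (nat \<Rightarrow> 'x \<Rightarrow> profile \<Rightarrow> profile \<Rightarrow> 'o \<Rightarrow> bool)
   \<Rightarrow> bool" where
  "query_lower_bound_sq Dom R \<longleftrightarrow>
     (\<exists>c>0. \<exists>N. \<forall>n\<ge>N. \<forall>(A :: 'x \<Rightarrow> 'o qtree pmf) q.
        rand_solves n (Dom n) (R n) A \<and> query_bounded n (Dom n) q A \<longrightarrow>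
        c * (real n)\<^sup>2 \<le> real q)"

end

theory Submission
  imports Defs
begin

text \<open>
  All problems reduce to set disjointness on about \<open>n\<^sup>2\<close> points, promised that the two sets meet in at most
  one point. The market built from sets \<open>x\<close> (women) and \<open>y\<close> (men) has exactly one stable marriage: the
  diagonal if \<open>x\<close> and \<open>y\<close> are disjoint, and a marriage sharing only a small fraction of couples with the
  diagonal if they meet in a single point, because the one eloping couple starts a chain that shifts
  almost all others. A correct answer to any of the problems tells the two cases apart.

  A query tree with \<open>q\<close> queries splits the pairs \<open>(x, y)\<close> into at most \<open>2 ^ q\<close> rectangles
  \<open>A \<times> B\<close>, so it suffices to show (Razborov's corruption bound) that a rectangle containing a
  non-negligible part of the disjoint pairs contains a comparable part of the pairs meeting in one point.
  Draw a disjoint pair by choosing \<open>z\<close> and then \<open>x \<subseteq> z\<close>, \<open>y \<subseteq> I - z\<close> uniformly. If \<open>A\<close> is large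
  below \<open>z\<close>, entropy forces almost all coordinates of its members to be nearly unbiased, and
  similarly for \<open>B\<close>. At an unbiased coordinate \<open>i\<close> the rectangle structure makes \<open>i \<in> x \<inter> y\<close> about as
  frequent as \<open>i \<notin> x \<union> y\<close>.
\<close>

subsection \<open>Biased coordinates of a family of sets\<close>

lemma sum_Pow_insert:
  fixes h :: "'a set \<Rightarrow> 'b::comm_monoid_add"
  assumes "finite J" "i \<notin> J"
  shows "(\<Sum>z\<in>Pow (insert i J). h z) = (\<Sum>z\<in>Pow J. h (insert i z) + h z)"
proof -
  have "inj_on (insert i) (Pow J)"
    using assms(2) by (auto simp: inj_on_def)
  moreover have "Pow J \<inter> insert i ` Pow J = {}"
    using assms(2) by auto
  ultimately show ?thesis
    using assms by (simp add: Pow_insert sum.union_disjoint sum.reindex sum.distrib add.commute)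
qed

text \<open>Expanding the product on the right chooses \<open>True\<close> or \<open>False\<close>
  at every \<open>i\<close>, that is, a subset of \<open>z\<close>. This yields the total mass of a
  product measure on \<open>Pow z\<close>.\<close>

lemma sum_Pow_prod:
  fixes f :: "'a \<Rightarrow> bool \<Rightarrow> 'b::comm_semiring_1"
  assumes "finite z"
  shows "(\<Sum>x\<in>Pow z. \<Prod>i\<in>z. f i (i \<in> x)) = (\<Prod>i\<in>z. f i True + f i False)"
  using assms
proof (induction z)
  case empty
  then show ?case by simp
next
  case (insert j z)
  have 1: "(\<Prod>i\<in>insert j z. f i (i \<in> insert j x)) = f j True * (\<Prod>i\<in>z. f i (i \<in> x))" for x
    using insert.hyps by (auto intro!: arg_cong[where f="(*) (f j True)"] prod.cong arg_cong[where f="f _"])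
  have 2: "(\<Prod>i\<in>insert j z. f i (i \<in> x)) = f j False * (\<Prod>i\<in>z. f i (i \<in> x))" if "x \<in> Pow z" for x
  proof -
    have "j \<notin> x" using insert.hyps that by auto
    then show ?thesis using insert.hyps by simp
  qed
  have "(\<Sum>x\<in>Pow (insert j z). \<Prod>i\<in>insert j z. f i (i \<in> x))
      = (\<Sum>x\<in>Pow z. f j True * (\<Prod>i\<in>z. f i (i \<in> x)) + f j False * (\<Prod>i\<in>z. f i (i \<in> x)))"
    unfolding sum_Pow_insert[OF insert.hyps] by (intro sum.cong arg_cong2[where f="(+)"] 1 2) auto
  also have "\<dots> = (f j True + f j False) * (\<Sum>x\<in>Pow z. \<Prod>i\<in>z. f i (i \<in> x))"
    by (simp add: sum_distrib_left distrib_right)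
  finally show ?case using insert by simp
qed

text \<open>This is \<open>2 / exp H\<close>, where \<open>H\<close> is the entropy (in nats) of a coin of bias 5/9.\<close>

definition bias_base :: real where
  "bias_base = 8/9 * (5/4) powr (5/9)"

lemma bias_base_gt_1: "bias_base > 1"
proof -
  \<comment> \<open>The ninth power clears the fractional exponent and leaves
    409600000/387420489.\<close>
  have "bias_base powr 9 = (8/9) powr 9 * (5/4) powr 5"
    unfolding bias_base_def by (subst powr_mult) (simp_all add: powr_powr)
  also have "\<dots> = (8/9)^9 * (5/4)^5"
    by simp
  also have "\<dots> > (1::real)"
    by (simp add: field_simps)
  finally have "bias_base powr 9 > 1 powr 9" by simp
  moreover have "bias_base \<ge> 0" by (simp add: bias_base_def)
  ultimately show ?thesis
    by (meson linorder_not_less powr_mono2 zero_le_numeral)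
qed

lemma sum_card_swap:
  assumes "finite A" "finite D"
  shows "(\<Sum>x\<in>A. card {i\<in>D. P x i}) = (\<Sum>i\<in>D. card {x\<in>A. P x i})"
proof -
  have "(\<Sum>x\<in>A. card {i\<in>D. P x i}) = (\<Sum>x\<in>A. \<Sum>i\<in>D. if P x i then 1 else 0)"
    using assms by (simp add: sum.If_cases Int_def)
  also have "\<dots> = (\<Sum>i\<in>D. \<Sum>x\<in>A. if P x i then 1 else 0)"
    by (rule sum.swap)
  also have "\<dots> = (\<Sum>i\<in>D. card {x\<in>A. P x i})"
    using assms by (simp add: sum.If_cases Int_def)
  finally show ?thesis .
qed

text \<open>Compare \<open>A\<close> with the product measure that gives every \<open>i \<in> D\<close> its majority value \<open>m i\<close>
  with probability 5/9; its total mass is at most 1, and convexity of \<open>exp\<close> bounds the mass of \<open>A\<close>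
  from below.\<close>

lemma card_biased_family:
  assumes z: "finite z" "D \<subseteq> z" "A \<subseteq> Pow z"
    and bias: "\<And>i. i \<in> D \<Longrightarrow> real (card {x\<in>A. (i \<in> x) = m i}) \<ge> 5/9 * real (card A)"
  shows "real (card A) * bias_base ^ card D \<le> 2 ^ card z"
proof -
  define d where "d = card D"
  define c where "c x = card {i\<in>D. (i \<in> x) = m i}" for x
  \<comment> \<open>Densities relative to fair coins: 10/9 = 2 * 5/9 and 8/9 = 2 * 4/9.\<close>
  define f :: "'a \<Rightarrow> bool \<Rightarrow> real"
    where "f i b = (if i \<in> D then if b = m i then 10/9 else 8/9 else 1)" for i b
  define K where "K = (5/4::real) powr (5/9 * d)"
  have fin: "finite D" "finite A"
    using z finite_subset by (auto simp: finite_subset)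
  have w: "(\<Prod>i\<in>z. f i (i \<in> x)) = (8/9) ^ d * (5/4) ^ c x" for x
  proof -
    have "(\<Prod>i\<in>z. f i (i \<in> x)) = (\<Prod>i\<in>D. f i (i \<in> x))"
      using z by (intro prod.mono_neutral_right) (auto simp: f_def)
    also have "\<dots> = (\<Prod>i\<in>D. 8/9 * (if (i \<in> x) = m i then 5/4 else 1))"
      by (intro prod.cong) (auto simp: f_def)
    also have "\<dots> = (8/9) ^ d * (\<Prod>i\<in>D. if (i \<in> x) = m i then 5/4 else 1)"
      by (simp only: prod.distrib d_def prod_constant)
    also have "(\<Prod>i\<in>D. if (i \<in> x) = m i then 5/4 else 1) = (5/4::real) ^ c x"
      using fin by (simp add: prod.If_cases c_def Int_def)
    finally show ?thesis .
  qed
  have "(\<Sum>x\<in>A. (8/9) ^ d * (5/4) ^ c x) \<le> (\<Sum>x\<in>Pow z. (8/9) ^ d * (5/4::real) ^ c x)"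
    using z by (intro sum_mono2) auto
  also have "\<dots> = (\<Prod>i\<in>z. f i True + f i False)"
    using sum_Pow_prod[OF z(1), of f] by (simp add: w)
  also have "\<dots> = (\<Prod>i\<in>z. 2)"
    by (intro prod.cong) (auto simp: f_def)
  also have "\<dots> = 2 ^ card z" by simp
  finally have upper: "(8/9) ^ d * (\<Sum>x\<in>A. (5/4) ^ c x) \<le> (2::real) ^ card z"
    by (simp add: sum_distrib_left)
  \<comment> \<open>The exponential lies above its tangent at \<open>c x = 5/9 * d\<close>, where
    its value is \<open>K\<close>. Summed over \<open>A\<close>, the linear term is nonnegative by
    \<open>avg\<close>.\<close>
  have conv: "K * (1 + (real (c x) - 5/9 * d) * ln (5/4)) \<le> (5/4) ^ c x" for x
  proof -
    have "1 + (real (c x) - 5/9 * d) * ln (5/4) \<le> exp ((real (c x) - 5/9 * d) * ln (5/4))"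
      by (rule exp_ge_add_one_self)
    also have "\<dots> = (5/4) powr (real (c x) - 5/9 * d)"
      by (simp add: powr_def)
    finally have "K * (1 + (real (c x) - 5/9 * d) * ln (5/4)) \<le> K * (5/4) powr (real (c x) - 5/9 * d)"
      by (intro mult_left_mono) (auto simp: K_def)
    also have "\<dots> = (5/4) powr real (c x)"
      by (simp add: K_def powr_add[symmetric])
    finally show ?thesis by (simp add: powr_realpow)
  qed
  have avg: "(\<Sum>x\<in>A. real (c x)) \<ge> 5/9 * d * card A"
  proof -
    have "(\<Sum>x\<in>A. real (c x)) = real (\<Sum>i\<in>D. card {x\<in>A. (i \<in> x) = m i})"
      unfolding c_def by (subst sum_card_swap[OF fin(2,1), symmetric]) simp
    also have "\<dots> \<ge> (\<Sum>i\<in>D. 5/9 * real (card A))"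
      unfolding of_nat_sum by (intro sum_mono bias)
    finally show ?thesis by (simp add: d_def)
  qed
  have "K * card A \<le> K * (card A + (\<Sum>x\<in>A. real (c x) - 5/9 * d) * ln (5/4))"
    using avg by (intro mult_left_mono) (auto simp: K_def sum_subtractf algebra_simps)
  also have "\<dots> = (\<Sum>x\<in>A. K * (1 + (real (c x) - 5/9 * d) * ln (5/4)))"
    by (simp add: sum_distrib_left[symmetric] sum_distrib_right sum.distrib)
  also have "\<dots> \<le> (\<Sum>x\<in>A. (5/4) ^ c x)"
    by (intro sum_mono conv)
  finally have "(8/9) ^ d * (K * card A) \<le> 2 ^ card z"
    using upper by (smt (verit) mult_left_mono zero_le_divide_iff zero_le_power)
  moreover have "bias_base ^ d = (8/9) ^ d * K"
    by (simp only: bias_base_def K_def power_mult_distrib powr_powr[symmetric]) (simp add: powr_realpow)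
  ultimately show ?thesis by (simp add: d_def mult_ac)
qed

subsection \<open>Rectangles and disjointness\<close>

definition below :: "'a set set \<Rightarrow> 'a set \<Rightarrow> nat" where
  "below A z = card {x\<in>A. x \<subseteq> z}"

definition below_in :: "'a set set \<Rightarrow> 'a \<Rightarrow> 'a set \<Rightarrow> nat" where
  "below_in A i z = card {x\<in>A. x \<subseteq> z \<and> i \<in> x}"

definition below_out :: "'a set set \<Rightarrow> 'a \<Rightarrow> 'a set \<Rightarrow> nat" where
  "below_out A i z = card {x\<in>A. x \<subseteq> z \<and> i \<notin> x}"

lemma below_split: "finite z \<Longrightarrow> below A z = below_out A i z + below_in A i z"
proof -
  assume "finite z"
  then have "finite {x\<in>A. x \<subseteq> z}" by simp
  then have fin: "finite {x\<in>A. x \<subseteq> z \<and> i \<notin> x}" "finite {x\<in>A. x \<subseteq> z \<and> i \<in> x}"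
    by (auto elim: rev_finite_subset)
  have "{x\<in>A. x \<subseteq> z} = {x\<in>A. x \<subseteq> z \<and> i \<notin> x} \<union> {x\<in>A. x \<subseteq> z \<and> i \<in> x}" by auto
  then show ?thesis
    unfolding below_def below_in_def below_out_def
    using card_Un_disjoint[OF fin] by (auto simp: disjoint_iff)
qed

text \<open>Members of \<open>A\<close> that avoid \<open>i\<close> do not notice whether
  \<open>i\<close> is allowed; this links the terms for \<open>z\<close> and
  \<open>insert i z\<close>.\<close>

lemma below_out_eq: "i \<notin> z \<Longrightarrow> below_out A i (insert i z) = below A z"
  unfolding below_out_def below_def by (rule arg_cong[where f=card]) auto

lemma below_le: "finite z \<Longrightarrow> below A z \<le> 2 ^ card z"
  unfolding below_def by (subst card_Pow[symmetric]) (auto intro!: card_mono)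

definition bad :: "'a set set \<Rightarrow> 'a set \<Rightarrow> 'a set" where
  "bad A z = {i\<in>z. 5/9 * real (below A z) < real (below_in A i z)
                 \<or> 5/9 * real (below A z) < real (below_out A i z)}"

text \<open>If neither value of a coordinate takes more than 5/9 of the members, each takes at least
  4/9, and 5/9 : 4/9 = 5/4.\<close>

lemma not_badD:
  assumes "finite z" "i \<in> z" "i \<notin> bad A z"
  shows "real (below_out A i z) \<le> 5/4 * real (below_in A i z)"
    and "real (below_in A i z) \<le> 5/4 * real (below_out A i z)"
  using assms below_split[OF assms(1), of A i] by (auto simp: bad_def)

lemma below_bad:
  assumes "finite z"
  shows "real (below A z) * bias_base ^ card (bad A z) \<le> 2 ^ card z"
  unfolding below_def
proof (rule card_biased_family[OF assms,
      where m = "\<lambda>i. 5/9 * real (below A z) < real (below_in A i z)"])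
  fix i assume i: "i \<in> bad A z"
  show "5/9 * real (card {x \<in> A. x \<subseteq> z})
      \<le> real (card {x \<in> {x\<in>A. x \<subseteq> z}. (i \<in> x) = (5/9 * real (below A z) < real (below_in A i z))})"
  proof (cases "5/9 * real (below A z) < real (below_in A i z)")
    case True
    then show ?thesis by (simp add: below_def below_in_def)
  next
    case False
    then have "5/9 * real (below A z) < real (below_out A i z)" using i by (auto simp: bad_def)
    with False show ?thesis by (simp add: below_def below_out_def)
  qed
qed (auto simp: bad_def)

text \<open>Either at most N/100 coordinates are bad, which gives the term with 1/100, or there are
  more, and then \<open>below_bad\<close> makes the number of members of \<open>A\<close> below
  \<open>z\<close> exponentially small compared with \<open>2 ^ card z\<close>.\<close>

lemma bad_weight:
  assumes I: "finite I" "card I = N" and z: "z \<subseteq> I"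
  shows "real (card (bad A z)) * (real (below A z) * real (below B (I - z)))
      \<le> real N * (2 ^ N * bias_base powr (- (real N / 100))
                + 1/100 * (real (below A z) * real (below B (I - z))))"
proof -
  have fz: "finite z" using I z finite_subset by blast
  have le: "card (bad A z) \<le> N"
    using I z by (auto simp: bad_def intro!: card_mono)
  let ?ab = "real (below A z) * real (below B (I - z))"
  let ?E = "bias_base powr (- (real N / 100))"
  show ?thesis
  proof (cases "real (card (bad A z)) \<le> real N / 100")
    case True
    then have "real (card (bad A z)) * ?ab \<le> real N / 100 * ?ab"
      by (intro mult_right_mono) auto
    also have "\<dots> \<le> real N * (2 ^ N * ?E + 1/100 * ?ab)"
      by (simp add: algebra_simps)
    finally show ?thesis .
  next
    case False
    have b1: "bias_base > 1" by (rule bias_base_gt_1)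
    have "real (below A z) * bias_base powr (real N / 100) \<le> real (below A z) * bias_base powr card (bad A z)"
      using False b1 by (intro mult_left_mono powr_mono) auto
    also have "\<dots> \<le> 2 ^ card z"
      using below_bad[OF fz, of A] b1 by (simp add: powr_realpow)
    finally have a: "real (below A z) \<le> 2 ^ card z * ?E"
      using b1 by (simp add: powr_minus field_simps)
    have "real (below B (I - z)) \<le> 2 ^ card (I - z)"
      using below_le[of "I - z" B] I by (metis finite_Diff of_nat_le_iff of_nat_numeral of_nat_power)
    with a have "?ab \<le> (2 ^ card z * ?E) * 2 ^ card (I - z)"
      by (intro mult_mono) auto
    also have "\<dots> = 2 ^ N * ?E"
      using z fz I card_mono[OF I(1) z] by (simp add: card_Diff_subset power_add[symmetric])
    finally have ab: "?ab \<le> 2 ^ N * ?E" .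
    have "real (card (bad A z)) * ?ab \<le> real N * (2 ^ N * ?E)"
      using le by (intro mult_mono[OF _ ab]) auto
    also have "\<dots> \<le> real N * (2 ^ N * ?E + 1/100 * ?ab)"
      by (intro mult_left_mono) auto
    finally show ?thesis .
  qed
qed

text \<open>Here \<open>f0\<close>, \<open>f1\<close> count the members of \<open>A\<close> without
  and with a point \<open>i\<close>, and \<open>g0\<close>, \<open>g1\<close> those of
  \<open>B\<close>; \<open>P\<close> and \<open>Q\<close> say that \<open>A\<close> and
  \<open>B\<close> are biased at \<open>i\<close>. If neither is, then \<open>q\<close> and
  \<open>r\<close> are at most \<open>5/4 * s\<close> and \<open>p\<close> is at most
  \<open>25/16 * s\<close>, which adds up to 45/8. If exactly one is, the other term on the left is
  at most 9/4 times the biased one, and 13/4 = 1 + 9/4.\<close>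

lemma good_split_arith:
  fixes f0 f1 g0 g1 :: real
  assumes nn: "f0 \<ge> 0" "f1 \<ge> 0" "g0 \<ge> 0" "g1 \<ge> 0"
    and A: "\<not> P \<Longrightarrow> f0 \<le> 5/4 * f1 \<and> f1 \<le> 5/4 * f0"
    and B: "\<not> Q \<Longrightarrow> g0 \<le> 5/4 * g1 \<and> g1 \<le> 5/4 * g0"
  shows "(f0 + f1) * g0 + f0 * (g0 + g1) \<le> 45/8 * (f1 * g1)
     + 13/4 * ((if P then (f0 + f1) * g0 else 0) + (if Q then f0 * (g0 + g1) else 0))"
proof -
  define p q r s where pqrs: "p = f0 * g0" "q = f1 * g0" "r = f0 * g1" "s = f1 * g1"
  have Q: "4 * r \<le> 5 * p" "4 * q \<le> 5 * s" if "\<not> Q"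
    using B[OF that] nn mult_left_mono[of g1 "5/4 * g0" f0] mult_left_mono[of g0 "5/4 * g1" f1]
    by (simp_all add: mult_ac pqrs)
  have P: "4 * q \<le> 5 * p" "4 * r \<le> 5 * s" "4 * p \<le> 5 * q" if "\<not> P"
    using A[OF that] nn mult_right_mono[of f1 "5/4 * f0" g0] mult_right_mono[of f0 "5/4 * f1" g1]
      mult_right_mono[of f0 "5/4 * f1" g0]
    by (simp_all add: mult_ac pqrs)
  have nonneg: "0 \<le> p" "0 \<le> q" "0 \<le> r" "0 \<le> s"
    using nn by (auto simp: pqrs)
  have main: "8 * (p + q + (p + r)) \<le> 45 * s + 26 * ((if P then p + q else 0) + (if Q then p + r else 0))"
    using P Q nonneg by (cases P; cases Q) auto
  have eqs: "(f0 + f1) * g0 = p + q" "f0 * (g0 + g1) = p + r"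
    by (simp_all add: pqrs algebra_simps)
  have "L \<le> 45/8 * s + 13/4 * W" if "8 * L \<le> 45 * s + 26 * W" for L W :: real
    using that by (simp add: field_simps)
  from this[OF main] show ?thesis
    unfolding eqs pqrs(4)[symmetric] .
qed

text \<open>\<open>disj_mass\<close> is, up to the factor \<open>4 ^ card I\<close>, the probability that \<open>(x, y) \<in> A \<times> B\<close> when
  \<open>z \<subseteq> I\<close>, \<open>x \<subseteq> z\<close> and \<open>y \<subseteq> I - z\<close> are uniform. For \<open>meet_mass\<close> a uniform point \<open>i\<close> is set
  aside first and then added to both \<open>x\<close> and \<open>y\<close>.\<close>

definition disj_mass :: "'a set \<Rightarrow> 'a set set \<Rightarrow> 'a set set \<Rightarrow> real" where
  "disj_mass I A B = (\<Sum>z\<in>Pow I. real (below A z) * real (below B (I - z)))"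

definition meet_mass :: "'a set \<Rightarrow> 'a set set \<Rightarrow> 'a set set \<Rightarrow> real" where
  "meet_mass I A B = (\<Sum>i\<in>I. \<Sum>z\<in>Pow (I - {i}).
      real (below_in A i (insert i z)) * real (below_in B i (I - z)))"

lemma sum_Pow_remove:
  fixes h :: "'a set \<Rightarrow> 'b::comm_monoid_add"
  assumes "finite I" "i \<in> I"
  shows "(\<Sum>z\<in>Pow I. h z) = (\<Sum>z\<in>Pow (I - {i}). h (insert i z) + h z)"
  using sum_Pow_insert[of "I - {i}" i h] assms by (simp add: insert_absorb)

lemma bad_mass:
  assumes I: "finite I" "card I = N"
  shows "(\<Sum>z\<in>Pow I. real (card (bad A z)) * (real (below A z) * real (below B (I - z))))
      \<le> real N * (4 ^ N * bias_base powr (- (real N / 100)) + 1/100 * disj_mass I A B)"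
proof -
  let ?ab = "\<lambda>z. real (below A z) * real (below B (I - z))"
  let ?E = "bias_base powr (- (real N / 100))"
  have "(\<Sum>z\<in>Pow I. real (card (bad A z)) * ?ab z)
      \<le> (\<Sum>z\<in>Pow I. real N * (2 ^ N * ?E + 1/100 * ?ab z))"
    by (intro sum_mono bad_weight I) auto
  also have "\<dots> = real N * ((\<Sum>z\<in>Pow I. 2 ^ N * ?E) + 1/100 * disj_mass I A B)"
    unfolding disj_mass_def by (simp only: sum_distrib_left[symmetric] sum.distrib)
  also have "(\<Sum>z\<in>Pow I. 2 ^ N * ?E) = 4 ^ N * ?E"
    using I power_mult_distrib[of "2::real" 2 N] by (simp add: card_Pow)
  finally show ?thesis .
qed

lemma disj_mass_commute: "finite I \<Longrightarrow> disj_mass I A B = disj_mass I B A"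
  unfolding disj_mass_def
  by (rule sum.reindex_bij_witness[of _ "\<lambda>z. I - z" "\<lambda>z. I - z"]) (auto simp: double_diff mult.commute)

text \<open>A tree that errs with probability at most 1/3 is contradicted because
  \<open>45/8 * 1/4 * 1/3 < 374/400 * 2/3\<close>; the factor 1/4 is the ratio of the total masses divided by \<open>N\<close>.\<close>

lemma rectangle_corruption:
  assumes I: "finite I" "card I = N"
  shows "45/8 * meet_mass I A B \<ge> real N * (374/400 * disj_mass I A B
      - 13/2 * (4 ^ N * bias_base powr (- (real N / 100))))"
proof -
  let ?ab = "\<lambda>z. real (below A z) * real (below B (I - z))"
  let ?E = "4 ^ N * bias_base powr (- (real N / 100))"
  define hA where "hA i z = (if i \<in> bad A z then ?ab z else 0)" for i z
  define hB where "hB i z = (if i \<in> bad B (I - z) then ?ab z else 0)" for i z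
  have step: "?ab (insert i z) + ?ab z
     \<le> 45/8 * (real (below_in A i (insert i z)) * real (below_in B i (I - z)))
       + 13/4 * ((hA i (insert i z) + hA i z) + (hB i (insert i z) + hB i z))"
    if i: "i \<in> I" and z: "z \<in> Pow (I - {i})" for i z
  proof -
    have fz: "finite (insert i z)" "finite (I - z)" using I z by (auto elim: finite_subset)
    have iz: "i \<notin> z" "i \<in> I - z" using i z by auto
    have IZ: "insert i (I - insert i z) = I - z" using i z by auto
    have fA: "real (below A (insert i z)) = real (below_out A i (insert i z)) + real (below_in A i (insert i z))"
      using below_split[OF fz(1), of A i] by simp
    have fB: "real (below B (I - z)) = real (below_out B i (I - z)) + real (below_in B i (I - z))"
      using below_split[OF fz(2), of B i] by simp
    have f0: "below A z = below_out A i (insert i z)" using below_out_eq[OF iz(1)] by simp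
    have g0: "below B (I - insert i z) = below_out B i (I - z)"
      using below_out_eq[of i "I - insert i z" B] by (simp add: IZ)
    \<comment> \<open>Neither \<open>z\<close> nor \<open>I - insert i z\<close> contains
      \<open>i\<close>, so one of the two bias terms vanishes for \<open>A\<close> and one for
      \<open>B\<close>.\<close>
    have h0: "hA i z = 0" "hB i (insert i z) = 0" using iz by (auto simp: hA_def hB_def bad_def)
    let ?f0 = "real (below_out A i (insert i z))" and ?f1 = "real (below_in A i (insert i z))"
    let ?g0 = "real (below_out B i (I - z))" and ?g1 = "real (below_in B i (I - z))"
    have hA: "hA i (insert i z) = (if i \<in> bad A (insert i z) then (?f0 + ?f1) * ?g0 else 0)"
      by (simp add: hA_def fA g0)
    have hB: "hB i z = (if i \<in> bad B (I - z) then ?f0 * (?g0 + ?g1) else 0)"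
      by (simp add: hB_def fB f0)
    have lhs: "?ab (insert i z) + ?ab z = (?f0 + ?f1) * ?g0 + ?f0 * (?g0 + ?g1)"
      by (simp add: fA fB f0 g0)
    show ?thesis
      unfolding lhs hA hB h0 add_0_left add_0_right
      by (rule good_split_arith) (use not_badD[OF fz(1), of i A] not_badD[OF fz(2) iz(2), of B] in auto)
  qed
  have rem: "(\<Sum>i\<in>I. \<Sum>z\<in>Pow (I - {i}). h i (insert i z) + h i z) = (\<Sum>i\<in>I. \<Sum>z\<in>Pow I. h i z)"
    for h :: "'a \<Rightarrow> 'a set \<Rightarrow> real"
    by (intro sum.cong refl sum_Pow_remove[OF I(1), symmetric])
  have swapA: "(\<Sum>i\<in>I. \<Sum>z\<in>Pow I. hA i z) \<le> real N * (?E + 1/100 * disj_mass I A B)"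
  proof -
    have "(\<Sum>i\<in>I. \<Sum>z\<in>Pow I. hA i z) = (\<Sum>z\<in>Pow I. \<Sum>i\<in>I. hA i z)" by (rule sum.swap)
    also have "\<dots> = (\<Sum>z\<in>Pow I. real (card (bad A z)) * ?ab z)"
    proof (rule sum.cong[OF refl])
      fix z assume "z \<in> Pow I"
      then have "I \<inter> {i. i \<in> bad A z} = bad A z" by (auto simp: bad_def)
      then show "(\<Sum>i\<in>I. hA i z) = real (card (bad A z)) * ?ab z"
        using I by (simp add: hA_def sum.If_cases)
    qed
    also have "\<dots> \<le> real N * (?E + 1/100 * disj_mass I A B)" by (rule bad_mass[OF I])
    finally show ?thesis .
  qed
  have swapB: "(\<Sum>i\<in>I. \<Sum>z\<in>Pow I. hB i z) \<le> real N * (?E + 1/100 * disj_mass I A B)"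
  proof -
    have "(\<Sum>i\<in>I. \<Sum>z\<in>Pow I. hB i z) = (\<Sum>z\<in>Pow I. \<Sum>i\<in>I. hB i z)" by (rule sum.swap)
    also have "\<dots> = (\<Sum>z\<in>Pow I. real (card (bad B (I - z))) * ?ab z)"
    proof (rule sum.cong[OF refl])
      fix z assume "z \<in> Pow I"
      then have "I \<inter> {i. i \<in> bad B (I - z)} = bad B (I - z)" by (auto simp: bad_def)
      then show "(\<Sum>i\<in>I. hB i z) = real (card (bad B (I - z))) * ?ab z"
        using I by (simp add: hB_def sum.If_cases)
    qed
    also have "\<dots> = (\<Sum>z\<in>Pow I. real (card (bad B z)) * (real (below B z) * real (below A (I - z))))"
      by (rule sum.reindex_bij_witness[of _ "\<lambda>z. I - z" "\<lambda>z. I - z"]) (auto simp: double_diff)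
    also have "\<dots> \<le> real N * (?E + 1/100 * disj_mass I B A)" by (rule bad_mass[OF I])
    finally show ?thesis using disj_mass_commute[OF I(1), of A B] by simp
  qed
  \<comment> \<open>For each of the \<open>N\<close> points \<open>i\<close>, the pairs
    \<open>insert i z\<close>, \<open>z\<close> run through \<open>Pow I\<close> exactly
    once.\<close>
  have "real N * disj_mass I A B = (\<Sum>i\<in>I. \<Sum>z\<in>Pow (I - {i}). ?ab (insert i z) + ?ab z)"
    using I rem[of "\<lambda>_. ?ab"] by (simp add: disj_mass_def)
  also have "\<dots> \<le> (\<Sum>i\<in>I. \<Sum>z\<in>Pow (I - {i}).
     45/8 * (real (below_in A i (insert i z)) * real (below_in B i (I - z)))
       + 13/4 * ((hA i (insert i z) + hA i z) + (hB i (insert i z) + hB i z)))"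
    by (intro sum_mono step)
  also have "\<dots> = 45/8 * meet_mass I A B + 13/4 * ((\<Sum>i\<in>I. \<Sum>z\<in>Pow (I - {i}). hA i (insert i z) + hA i z)
      + (\<Sum>i\<in>I. \<Sum>z\<in>Pow (I - {i}). hB i (insert i z) + hB i z))"
    unfolding meet_mass_def by (simp only: sum.distrib sum_distrib_left[symmetric])
  also have "\<dots> = 45/8 * meet_mass I A B + 13/4 * ((\<Sum>i\<in>I. \<Sum>z\<in>Pow I. hA i z) + (\<Sum>i\<in>I. \<Sum>z\<in>Pow I. hB i z))"
    by (simp only: rem)
  also have "\<dots> \<le> 45/8 * meet_mass I A B + 13/4 * (real N * (?E + 1/100 * disj_mass I A B)
      + real N * (?E + 1/100 * disj_mass I A B))"
    using swapA swapB by (intro add_left_mono mult_left_mono add_mono) auto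
  \<comment> \<open>Collecting terms: 1 - 2 * 13/4 * 1/100 = 374/400, and the exponential error
    occurs twice.\<close>
  finally show ?thesis by (simp add: algebra_simps)
qed

section \<open>Pairs weighted by the number of draws that can produce them\<close>

definition disj_weight :: "'a set \<Rightarrow> 'a set \<Rightarrow> 'a set \<Rightarrow> real" where
  "disj_weight I x y = (\<Sum>z\<in>Pow I. of_bool (x \<subseteq> z) * of_bool (y \<subseteq> I - z))"

definition meet_weight :: "'a set \<Rightarrow> 'a set \<Rightarrow> 'a set \<Rightarrow> real" where
  "meet_weight I x y = (\<Sum>i\<in>I. \<Sum>z\<in>Pow (I - {i}).
      of_bool (x \<subseteq> insert i z \<and> i \<in> x) * of_bool (y \<subseteq> I - z \<and> i \<in> y))"

lemma sum_of_bool_card: "finite A \<Longrightarrow> (\<Sum>x\<in>A. of_bool (P x)) = real (card {x\<in>A. P x})"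
  by (simp add: of_bool_def sum.If_cases Int_def)

lemma sum_disj_weight:
  assumes "finite A" "finite B"
  shows "(\<Sum>x\<in>A. \<Sum>y\<in>B. disj_weight I x y) = disj_mass I A B"
proof -
  have "disj_mass I A B = (\<Sum>z\<in>Pow I. \<Sum>x\<in>A. \<Sum>y\<in>B. of_bool (x \<subseteq> z) * of_bool (y \<subseteq> I - z))"
    unfolding disj_mass_def below_def using assms
    by (simp only: sum_of_bool_card[symmetric] sum_product)
  also have "\<dots> = (\<Sum>x\<in>A. \<Sum>z\<in>Pow I. \<Sum>y\<in>B. of_bool (x \<subseteq> z) * of_bool (y \<subseteq> I - z))"
    by (rule sum.swap)
  also have "\<dots> = (\<Sum>x\<in>A. \<Sum>y\<in>B. disj_weight I x y)"
    unfolding disj_weight_def by (intro sum.cong refl sum.swap)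
  finally show ?thesis by simp
qed

lemma sum_meet_weight:
  assumes "finite A" "finite B"
  shows "(\<Sum>x\<in>A. \<Sum>y\<in>B. meet_weight I x y) = meet_mass I A B"
proof -
  let ?t = "\<lambda>i z x y. of_bool (x \<subseteq> insert i z \<and> i \<in> x) * (of_bool (y \<subseteq> I - z \<and> i \<in> y) :: real)"
  have "meet_mass I A B = (\<Sum>i\<in>I. \<Sum>z\<in>Pow (I - {i}). \<Sum>x\<in>A. \<Sum>y\<in>B. ?t i z x y)"
    unfolding meet_mass_def below_in_def using assms
    by (simp only: sum_of_bool_card[symmetric] sum_product)
  also have "\<dots> = (\<Sum>i\<in>I. \<Sum>x\<in>A. \<Sum>z\<in>Pow (I - {i}). \<Sum>y\<in>B. ?t i z x y)"
    by (intro sum.cong refl sum.swap)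
  also have "\<dots> = (\<Sum>x\<in>A. \<Sum>i\<in>I. \<Sum>z\<in>Pow (I - {i}). \<Sum>y\<in>B. ?t i z x y)"
    by (rule sum.swap)
  also have "\<dots> = (\<Sum>x\<in>A. \<Sum>i\<in>I. \<Sum>y\<in>B. \<Sum>z\<in>Pow (I - {i}). ?t i z x y)"
    by (intro sum.cong refl sum.swap)
  also have "\<dots> = (\<Sum>x\<in>A. \<Sum>y\<in>B. meet_weight I x y)"
    unfolding meet_weight_def by (intro sum.cong refl sum.swap)
  finally show ?thesis by simp
qed

lemma disj_weight_nonneg: "disj_weight I x y \<ge> 0"
  unfolding disj_weight_def by (intro sum_nonneg) auto

lemma meet_weight_nonneg: "meet_weight I x y \<ge> 0"
  unfolding meet_weight_def by (intro sum_nonneg) auto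

lemma disj_weight_support: "disj_weight I x y \<noteq> 0 \<Longrightarrow> x \<inter> y = {}"
proof -
  assume "disj_weight I x y \<noteq> 0"
  then obtain z where "of_bool (x \<subseteq> z) * of_bool (y \<subseteq> I - z) \<noteq> (0::real)"
    unfolding disj_weight_def by (meson sum.not_neutral_contains_not_neutral)
  then show ?thesis by (auto split: if_splits)
qed

text \<open>The sets \<open>insert i z\<close> and \<open>I - z\<close> share only the point
  \<open>i\<close>.\<close>

lemma meet_weight_support: "meet_weight I x y \<noteq> 0 \<Longrightarrow> \<exists>i\<in>I. x \<inter> y = {i}"
proof -
  assume "meet_weight I x y \<noteq> 0"
  then obtain i z where "i \<in> I"
    "of_bool (x \<subseteq> insert i z \<and> i \<in> x) * of_bool (y \<subseteq> I - z \<and> i \<in> y) \<noteq> (0::real)"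
    unfolding meet_weight_def by (meson sum.not_neutral_contains_not_neutral)
  then show ?thesis by (intro bexI[of _ i]) auto
qed

lemma below_Pow: "finite I \<Longrightarrow> z \<subseteq> I \<Longrightarrow> below (Pow I) z = 2 ^ card z"
proof -
  assume "finite I" "z \<subseteq> I"
  moreover from this have "{x \<in> Pow I. x \<subseteq> z} = Pow z" by auto
  ultimately show ?thesis by (simp add: below_def card_Pow finite_subset)
qed

lemma below_in_Pow:
  assumes "finite I" "i \<in> I" "z \<subseteq> I - {i}"
  shows "below_in (Pow I) i (insert i z) = 2 ^ card z"
proof -
  have z: "finite z" "i \<notin> z" "z \<subseteq> I" "insert i z \<subseteq> I" using assms finite_subset by auto
  show ?thesis
    using below_split[of "insert i z" "Pow I" i] z assms(1)
    by (simp add: below_out_eq below_Pow)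
qed

lemma disj_mass_total:
  assumes "finite I"
  shows "disj_mass I (Pow I) (Pow I) = 4 ^ card I"
proof -
  have "real (below (Pow I) z) * real (below (Pow I) (I - z)) = 2 ^ card I" if "z \<in> Pow I" for z
  proof -
    have "card z + card (I - z) = card I"
      using that assms by (metis PowD card_Diff_subset card_mono finite_subset le_add_diff_inverse)
    then show ?thesis using that assms by (simp add: below_Pow power_add[symmetric])
  qed
  then show ?thesis
    using assms power_mult_distrib[of "2::real" 2 "card I"] by (simp add: disj_mass_def card_Pow)
qed

text \<open>There are \<open>card I\<close> choices of \<open>i\<close> and
  \<open>2 ^ (card I - 1)\<close> of \<open>z\<close>, each allowing \<open>2 ^ (card I - 1)\<close>
  pairs. The factor 4 keeps the truncated exponent out of the statement.\<close>

lemma meet_mass_total: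
  assumes "finite I"
  shows "4 * meet_mass I (Pow I) (Pow I) = card I * 4 ^ card I"
proof -
  have *: "real (below_in (Pow I) i (insert i z)) * real (below_in (Pow I) i (I - z)) = 2 ^ (card I - 1)"
    if i: "i \<in> I" and z: "z \<in> Pow (I - {i})" for i z
  proof -
    have "I - z = insert i (I - {i} - z)" using i z by auto
    then have b: "below_in (Pow I) i (I - z) = 2 ^ card (I - {i} - z)"
      using below_in_Pow[OF assms i, of "I - {i} - z"] by auto
    have "card z + card (I - {i} - z) = card (I - {i})"
      using z assms by (metis PowD card_Diff_subset card_mono finite_subset le_add_diff_inverse finite_Diff)
    then show ?thesis using b below_in_Pow[OF assms i, of z] z i assms by (simp add: power_add[symmetric])
  qed
  have 4: "4 * (2 ^ (card I - 1) * 2 ^ (card I - 1)) = (4::real) ^ card I" if "i \<in> I" for i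
  proof -
    have "card I \<noteq> 0" using that assms by auto
    then have "(4::real) ^ card I = 4 * 4 ^ (card I - 1)" by (metis power_eq_if)
    then show ?thesis using power_mult_distrib[of "2::real" 2 "card I - 1"] by simp
  qed
  have "4 * meet_mass I (Pow I) (Pow I) = (\<Sum>i\<in>I. 4 * (2 ^ (card I - 1) * 2 ^ (card I - 1)))"
    unfolding meet_mass_def sum_distrib_left using assms
    by (intro sum.cong refl) (simp add: * card_Pow sum_distrib_left[symmetric])
  also have "\<dots> = (\<Sum>i\<in>I. 4 ^ card I)" by (intro sum.cong refl 4)
  finally show ?thesis by simp
qed

subsection \<open>Query trees for disjointness\<close>

text \<open>The inputs on which a tree accepts within \<open>q\<close> queries split into at most \<open>2 ^ q\<close> rectangles.\<close>

lemma qtree_sum_ge: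
  fixes \<phi> :: "'a \<Rightarrow> 'b \<Rightarrow> real"
  assumes fin: "finite X" "finite Y"
    and rect: "\<And>A B. A \<subseteq> X \<Longrightarrow> B \<subseteq> Y \<Longrightarrow> (\<Sum>x\<in>A. \<Sum>y\<in>B. \<phi> x y) \<ge> - e"
  shows "A \<subseteq> X \<Longrightarrow> B \<subseteq> Y \<Longrightarrow>
    (\<Sum>x\<in>A. \<Sum>y\<in>B. if queries T (F x) (G y) \<le> q \<and> g (run T (F x) (G y)) then \<phi> x y else 0) \<ge> - (2 ^ q * e)"
proof (induction T arbitrary: A B q)
  case (Leaf r)
  \<comment> \<open>The empty rectangle has sum 0, so its lower bound forces this.\<close>
  have e: "e \<ge> 0" using rect[of "{}" "{}"] by simp
  have "e \<le> 2 ^ q * e" using e mult_right_mono[of 1 "2 ^ q" e] by simp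
  with rect[OF Leaf] e show ?case by (cases "g r") auto
next
  case (QueryW f t1 t2)
  have e: "e \<ge> 0" using rect[of "{}" "{}"] by simp
  show ?case
  proof (cases q)
    \<comment> \<open>The root already costs one query, so no input is counted.\<close>
    case 0
    then show ?thesis using e by simp
  next
    case (Suc p)
    \<comment> \<open>A query about the women splits the rows into two rectangles, each left with
      one query less; a query about the men does the same to the columns.\<close>
    have halves: "- (2 ^ q * e) = - (2 ^ p * e) + - (2 ^ p * e)" by (simp add: Suc)
    let ?h = "\<lambda>T q x. \<Sum>y\<in>B. if queries T (F x) (G y) \<le> q \<and> g (run T (F x) (G y)) then \<phi> x y else 0"
    have A: "finite A" using QueryW.prems fin finite_subset by blast
    have "(\<Sum>x\<in>A. ?h (QueryW f t1 t2) q x) = (\<Sum>x\<in>A. if f (F x) then ?h t1 p x else ?h t2 p x)"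
      by (intro sum.cong) (auto simp: Suc)
    also have "\<dots> = (\<Sum>x\<in>A \<inter> {x. f (F x)}. ?h t1 p x) + (\<Sum>x\<in>A \<inter> - {x. f (F x)}. ?h t2 p x)"
      using A by (rule sum.If_cases)
    also have "\<dots> \<ge> - (2 ^ q * e)"
      unfolding halves using QueryW.prems by (intro add_mono QueryW.IH) auto
    finally show ?thesis .
  qed
next
  case (QueryM f t1 t2)
  have e: "e \<ge> 0" using rect[of "{}" "{}"] by simp
  show ?case
  proof (cases q)
    case 0
    then show ?thesis using e by simp
  next
    case (Suc p)
    have halves: "- (2 ^ q * e) = - (2 ^ p * e) + - (2 ^ p * e)" by (simp add: Suc)
    let ?h = "\<lambda>T q x y. if queries T (F x) (G y) \<le> q \<and> g (run T (F x) (G y)) then \<phi> x y else 0"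
    have B: "finite B" using QueryM.prems fin finite_subset by blast
    have "(\<Sum>x\<in>A. \<Sum>y\<in>B. ?h (QueryM f t1 t2) q x y)
        = (\<Sum>x\<in>A. \<Sum>y\<in>B. if f (G y) then ?h t1 p x y else ?h t2 p x y)"
      by (intro sum.cong) (auto simp: Suc)
    also have "\<dots> = (\<Sum>x\<in>A. (\<Sum>y\<in>B \<inter> {y. f (G y)}. ?h t1 p x y) + (\<Sum>y\<in>B \<inter> - {y. f (G y)}. ?h t2 p x y))"
      using B by (intro sum.cong refl sum.If_cases)
    also have "\<dots> = (\<Sum>x\<in>A. \<Sum>y\<in>B \<inter> {y. f (G y)}. ?h t1 p x y) + (\<Sum>x\<in>A. \<Sum>y\<in>B \<inter> - {y. f (G y)}. ?h t2 p x y)"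
      by (rule sum.distrib)
    also have "\<dots> \<ge> - (2 ^ q * e)"
      unfolding halves using QueryM.prems by (intro add_mono QueryM.IH) auto
    finally show ?thesis .
  qed
qed

text \<open>Here \<open>g\<close> reads an output as the claim that the sets are disjoint. The test
  function \<open>\<phi>\<close> has sum at least \<open>- e\<close> on every rectangle, so its
  expected sum over the accepted pairs is at least \<open>- (2 ^ q * e)\<close>. Correctness makes
  this sum at most a fixed negative multiple of \<open>N * 4 ^ N\<close>. As \<open>e\<close> is
  smaller than that by a factor exponential in \<open>N\<close>, \<open>q\<close> must grow linearly
  in \<open>N\<close>.\<close>

lemma disjointness_lower_bound:
  fixes D :: "'o qtree pmf" and I :: "'a set" and F G :: "'a set \<Rightarrow> profile"
  assumes I: "finite I"
    and bounded: "\<And>x y T. x \<subseteq> I \<Longrightarrow> y \<subseteq> I \<Longrightarrow> x \<inter> y = {} \<or> (\<exists>i\<in>I. x \<inter> y = {i}) \<Longrightarrow> T \<in> set_pmf D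
          \<Longrightarrow> queries T (F x) (G y) \<le> q"
    and disj: "\<And>x y. x \<subseteq> I \<Longrightarrow> y \<subseteq> I \<Longrightarrow> x \<inter> y = {}
          \<Longrightarrow> measure_pmf.prob D {T. g (run T (F x) (G y))} \<ge> 2/3"
    and meet: "\<And>x y i. x \<subseteq> I \<Longrightarrow> y \<subseteq> I \<Longrightarrow> i \<in> I \<Longrightarrow> x \<inter> y = {i}
          \<Longrightarrow> measure_pmf.prob D {T. \<not> g (run T (F x) (G y))} \<ge> 2/3"
  shows "ln bias_base / 100 * real (card I) \<le> real q + 6"
proof (cases "card I = 0")
  case True
  then show ?thesis by simp
next
  case False
  define N where "N = card I"
  define E where "E = bias_base powr (- (real N / 100))"
  define \<phi> where "\<phi> x y = 45/8 * meet_weight I x y - N * (374/400) * disj_weight I x y" for x y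
  define e where "e = N * (13/2 * (4 ^ N * E))"
  define acc where "acc x y = {T. g (run T (F x) (G y))}" for x y
  define pr where "pr x y = measure_pmf.prob D (acc x y)" for x y
  have N: "N > 0" using False by (simp add: N_def)
  have fin: "finite (Pow I)" using I by simp
  have rect: "(\<Sum>x\<in>A. \<Sum>y\<in>B. \<phi> x y) \<ge> - e" if "A \<subseteq> Pow I" "B \<subseteq> Pow I" for A B
  proof -
    have f: "finite A" "finite B" using that fin finite_subset by blast+
    have "(\<Sum>x\<in>A. \<Sum>y\<in>B. \<phi> x y) = 45/8 * meet_mass I A B - N * (374/400) * disj_mass I A B"
      unfolding \<phi>_def sum_meet_weight[OF f, symmetric] sum_disj_weight[OF f, symmetric]
      by (simp only: sum_subtractf sum_distrib_left)
    then show ?thesis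
      using rectangle_corruption[OF I, of N A B] by (simp add: N_def e_def E_def algebra_simps)
  qed
  have tree: "(\<Sum>x\<in>Pow I. \<Sum>y\<in>Pow I. \<phi> x y * indicator (acc x y) T) \<ge> - (2 ^ q * e)"
    if T: "T \<in> set_pmf D" for T
  proof -
    have "(\<Sum>x\<in>Pow I. \<Sum>y\<in>Pow I. \<phi> x y * indicator (acc x y) T)
       = (\<Sum>x\<in>Pow I. \<Sum>y\<in>Pow I. if queries T (F x) (G y) \<le> q \<and> g (run T (F x) (G y)) then \<phi> x y else 0)"
    proof (intro sum.cong refl)
      fix x y assume xy: "x \<in> Pow I" "y \<in> Pow I"
      \<comment> \<open>The budget is granted on promised inputs only; \<open>\<phi>\<close>
        vanishes on all others.\<close>
      have "queries T (F x) (G y) \<le> q" if "\<phi> x y \<noteq> 0"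
      proof (rule bounded[OF _ _ _ T])
        show "x \<inter> y = {} \<or> (\<exists>i\<in>I. x \<inter> y = {i})"
          using that disj_weight_support[of I x y] meet_weight_support[of I x y]
          by (cases "disj_weight I x y = 0") (auto simp: \<phi>_def)
      qed (use xy in auto)
      then show "\<phi> x y * indicator (acc x y) T
          = (if queries T (F x) (G y) \<le> q \<and> g (run T (F x) (G y)) then \<phi> x y else 0)"
        by (auto simp: acc_def indicator_def)
    qed
    also have "\<dots> \<ge> - (2 ^ q * e)"
      by (rule qtree_sum_ge[OF fin fin rect]) auto
    finally show ?thesis .
  qed
  have int: "integrable (measure_pmf D) (\<lambda>T. c * indicator (acc x y) T)" for x y and c :: real
    by (intro integrable_mult_right measure_pmf.integrable_const_bound[where B=1]) (auto simp: indicator_def)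
  have "- (2 ^ q * e) \<le> measure_pmf.expectation D (\<lambda>T. \<Sum>x\<in>Pow I. \<Sum>y\<in>Pow I. \<phi> x y * indicator (acc x y) T)"
    by (intro measure_pmf.integral_ge_const Bochner_Integration.integrable_sum int AE_pmfI tree)
  also have "\<dots> = (\<Sum>x\<in>Pow I. measure_pmf.expectation D (\<lambda>T. \<Sum>y\<in>Pow I. \<phi> x y * indicator (acc x y) T))"
    by (intro Bochner_Integration.integral_sum Bochner_Integration.integrable_sum int)
  also have "\<dots> = (\<Sum>x\<in>Pow I. \<Sum>y\<in>Pow I. measure_pmf.expectation D (\<lambda>T. \<phi> x y * indicator (acc x y) T))"
    by (intro sum.cong refl Bochner_Integration.integral_sum int)
  also have "\<dots> = (\<Sum>x\<in>Pow I. \<Sum>y\<in>Pow I. \<phi> x y * pr x y)"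
    by (simp add: pr_def)
  also have "\<dots> \<le> (\<Sum>x\<in>Pow I. \<Sum>y\<in>Pow I. 45/8 * (1/3) * meet_weight I x y
                    - N * (374/400) * (2/3) * disj_weight I x y)"
  proof (intro sum_mono)
    fix x y assume xy: "x \<in> Pow I" "y \<in> Pow I"
    have "meet_weight I x y * pr x y \<le> meet_weight I x y * (1/3)"
    proof (cases "meet_weight I x y = 0")
      case False
      then obtain i where "i \<in> I" "x \<inter> y = {i}" using meet_weight_support by blast
      then have "measure_pmf.prob D (- acc x y) \<ge> 2/3"
        using meet[of x y i] xy by (simp add: acc_def Collect_neg_eq)
      then have "pr x y \<le> 1/3"
        using measure_pmf.prob_compl[of "acc x y" D] by (simp add: pr_def Compl_eq_Diff_UNIV)
      then show ?thesis by (intro mult_left_mono meet_weight_nonneg)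
    qed simp
    moreover have "disj_weight I x y * pr x y \<ge> disj_weight I x y * (2/3)"
    proof (cases "disj_weight I x y = 0")
      case False
      then have "x \<inter> y = {}" using disj_weight_support by blast
      then have "pr x y \<ge> 2/3" using disj[of x y] xy by (simp add: acc_def pr_def)
      then show ?thesis by (intro mult_left_mono disj_weight_nonneg)
    qed simp
    from mult_left_mono[OF this, of "N * (374/400)"]
    have "N * (374/400) * (disj_weight I x y * (2/3)) \<le> N * (374/400) * (disj_weight I x y * pr x y)"
      by simp
    ultimately show "\<phi> x y * pr x y \<le> 45/8 * (1/3) * meet_weight I x y
                    - N * (374/400) * (2/3) * disj_weight I x y"
      unfolding \<phi>_def by (simp add: algebra_simps)
  qed
  also have "\<dots> = 45/8 * (1/3) * meet_mass I (Pow I) (Pow I) - N * (374/400) * (2/3) * disj_mass I (Pow I) (Pow I)"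
    unfolding sum_meet_weight[OF fin fin, symmetric] sum_disj_weight[OF fin fin, symmetric]
    by (simp only: sum_subtractf sum_distrib_left)
  \<comment> \<open>Since 45/8 * 1/3 * 1/4 - 374/400 * 2/3 = -371/2400.\<close>
  also have "\<dots> = - (N * 4 ^ N * (371/2400))"
    using meet_mass_total[OF I] disj_mass_total[OF I] by (simp add: N_def)
  finally have "N * 4 ^ N * (371/2400) \<le> N * 4 ^ N * (2 ^ q * (13/2 * E))"
    by (simp add: e_def algebra_simps)
  then have "371/2400 \<le> 2 ^ q * (13/2 * E)"
    using N by (subst (asm) mult_le_cancel_left_pos) auto
  \<comment> \<open>The ratio of 13/2 to 371/2400 is about 42, below \<open>2 ^ 6\<close>; this is
    the source of the summand 6.\<close>
  then have "1 \<le> 2 ^ q * 2 ^ 6 * E"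
    by simp
  then have le: "bias_base powr (real N / 100) \<le> 2 ^ (q + 6)"
    using bias_base_gt_1 by (simp add: E_def powr_minus field_simps power_add)
  have "real N / 100 * ln bias_base = ln (bias_base powr (real N / 100))"
    using bias_base_gt_1 by (simp add: ln_powr)
  also have "\<dots> \<le> ln (2 ^ (q + 6))"
    using le bias_base_gt_1 by (subst ln_le_cancel_iff) auto
  also have "\<dots> = (q + 6) * ln 2" by (simp add: ln_realpow)
  also have "\<dots> \<le> real (q + 6) * 1"
    using ln_le_minus_one[of "2::real"] by (intro mult_left_mono) auto
  finally show ?thesis by (simp add: N_def mult.commute)
qed

subsection \<open>A marriage market encoding disjointness\<close>

text \<open>For an absent \<open>y\<close> this is the whole list, in agreement with
  \<open>pos\<close>, which then returns the length.\<close>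

definition better :: "nat list \<Rightarrow> nat \<Rightarrow> nat set" where
  "better xs y = set (takeWhile (\<lambda>u. u \<noteq> y) xs)"

lemma pos_less_iff: "pos z xs < pos y xs \<longleftrightarrow> z \<in> better xs y"
  by (induction xs) (auto simp: better_def)

lemma prefers_iff: "prefers p a z y \<longleftrightarrow> z \<in> better (p a) y"
  by (simp add: prefers_def pos_less_iff)

lemma pos_inj: "z \<in> set xs \<Longrightarrow> pos y xs = pos z xs \<Longrightarrow> y = z"
  by (induction xs) (auto split: if_splits)

lemma better_linear: "z \<in> set xs \<Longrightarrow> y \<noteq> z \<Longrightarrow> y \<notin> better xs z \<Longrightarrow> z \<in> better xs y"
  using pos_inj[of z xs y] pos_less_iff[of y xs z] pos_less_iff[of z xs y] by linarith

lemma better_subset: "better xs y \<subseteq> set xs - {y}"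
  unfolding better_def by (auto dest: set_takeWhileD)

lemma better_append: "y \<in> set xs \<Longrightarrow> better (xs @ ys) y = better xs y"
  by (simp add: better_def takeWhile_append1)

lemma better_snoc: "y \<notin> set xs \<Longrightarrow> better (xs @ [y]) y = set xs"
  unfolding better_def by (subst takeWhile_append2) auto

lemma better_Cons: "better (a # xs) y = (if a = y then {} else insert a (better xs y))"
  by (auto simp: better_def)

lemma better_snoc_subset: "y \<in> set xs \<Longrightarrow> better (xs @ [c]) y \<subseteq> set xs - {y}"
  using better_subset[of xs y] by (simp add: better_append)

text \<open>The added tail only makes the list a permutation: comparisons with an entry of
  \<open>xs\<close> are settled inside \<open>xs\<close>.\<close>

definition complete_list :: "nat \<Rightarrow> nat list \<Rightarrow> nat list" where
  "complete_list n xs = xs @ filter (\<lambda>z. z \<notin> set xs) [0..<n]"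

lemma complete_list_perm:
  assumes "distinct xs" "set xs \<subseteq> {..<n}"
  shows "distinct (complete_list n xs)" "set (complete_list n xs) = {..<n}"
  using assms by (auto simp: complete_list_def)

lemma better_complete_list: "y \<in> set xs \<Longrightarrow> better (complete_list n xs) y = better xs y"
  by (simp add: complete_list_def better_append)

section \<open>Perfect and stable marriages\<close>

lemma husband_eq: "perfect n \<mu> \<Longrightarrow> (w, m) \<in> \<mu> \<Longrightarrow> husband \<mu> w = m"
  unfolding husband_def perfect_def by (rule the_equality) blast+

lemma wife_eq: "perfect n \<mu> \<Longrightarrow> (w, m) \<in> \<mu> \<Longrightarrow> wife \<mu> m = w"
  unfolding wife_def perfect_def by (rule the_equality) blast+

lemma stableI:
  assumes "perfect n \<mu>"
    and "\<And>w m h g. (w, h) \<in> \<mu> \<Longrightarrow> (g, m) \<in> \<mu> \<Longrightarrow> m \<in> better (pW w) h \<Longrightarrow> w \<in> better (pM m) g \<Longrightarrow> False"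
  shows "stable n pW pM \<mu>"
  unfolding stable_def blocking_def
proof (intro conjI allI notI assms(1); elim conjE)
  fix w m
  assume *: "w < n" "m < n" "prefers pW w m (husband \<mu> w)" "prefers pM m w (wife \<mu> m)"
  obtain h g where "(w, h) \<in> \<mu>" "(g, m) \<in> \<mu>"
    using assms(1) * unfolding perfect_def by metis
  with assms * show False
    by (metis husband_eq wife_eq prefers_iff)
qed

text \<open>If they were not married to each other, linearity of the lists would make both prefer
  the other to their spouse, and they would block. Uniqueness of the stable marriage is proved by
  forcing one couple after another in this way.\<close>

lemma stable_forced:
  assumes st: "stable n pW pM \<mu>" and val: "valid_profile n pW" "valid_profile n pM"
    and wm: "w < n" "m < n"
    and w: "\<And>h. (w, h) \<in> \<mu> \<Longrightarrow> h \<notin> better (pW w) m"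
    and m: "\<And>g. (g, m) \<in> \<mu> \<Longrightarrow> g \<notin> better (pM m) w"
  shows "(w, m) \<in> \<mu>"
proof (rule ccontr)
  assume no: "(w, m) \<notin> \<mu>"
  have p: "perfect n \<mu>" using st by (simp add: stable_def)
  then obtain h g where hg: "(w, h) \<in> \<mu>" "(g, m) \<in> \<mu>"
    using wm unfolding perfect_def by metis
  then have "h \<noteq> m" "g \<noteq> w" using no by auto
  moreover have "m \<in> set (pW w)" "w \<in> set (pM m)"
    using val wm by (auto simp: valid_profile_def)
  ultimately have "m \<in> better (pW w) h" "w \<in> better (pM m) g"
    using w m hg better_linear by metis+
  then have "blocking n pW pM \<mu> w m"
    using wm p hg by (simp add: blocking_def prefers_iff husband_eq wife_eq)
  then show False using st by (simp add: stable_def)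
qed

lemma perfect_husband_unique: "perfect n \<mu> \<Longrightarrow> (w, m) \<in> \<mu> \<Longrightarrow> (w, m') \<in> \<mu> \<Longrightarrow> m = m'"
  using husband_eq by metis

lemma perfect_wife_unique: "perfect n \<mu> \<Longrightarrow> (w, m) \<in> \<mu> \<Longrightarrow> (w', m) \<in> \<mu> \<Longrightarrow> w = w'"
  using wife_eq by metis

lemma perfect_subset_eq: 
  assumes "perfect n \<mu>" "perfect n \<mu>'" "\<mu> \<subseteq> \<mu>'"
  shows "\<mu> = \<mu>'"
proof -
  have "(w, m) \<in> \<mu>" if "(w, m) \<in> \<mu>'" for w m
  proof -
    have "w < n" using that assms(2) by (auto simp: perfect_def)
    then obtain m' where "(w, m') \<in> \<mu>" using assms(1) unfolding perfect_def by metis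
    then show ?thesis using assms that perfect_husband_unique by blast
  qed
  with assms(3) show ?thesis by auto
qed

definition graph_of :: "nat \<Rightarrow> (nat \<Rightarrow> nat) \<Rightarrow> (nat \<times> nat) set" where
  "graph_of n f = {(w, f w) | w. w < n}"

lemma perfect_graph_of:
  assumes "\<And>w. w < n \<Longrightarrow> f w < n \<and> g (f w) = w" "\<And>m. m < n \<Longrightarrow> g m < n \<and> f (g m) = m"
  shows "perfect n (graph_of n f)"
  unfolding perfect_def
proof (intro conjI allI impI)
  show "graph_of n f \<subseteq> {..<n} \<times> {..<n}"
    using assms(1) by (auto simp: graph_of_def)
  show "\<exists>!m. (w, m) \<in> graph_of n f" if "w < n" for w
    using that by (auto simp: graph_of_def)
  show "\<exists>!w. (w, m) \<in> graph_of n f" if "m < n" for m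
  proof (rule ex1I[of _ "g m"])
    show "(g m, m) \<in> graph_of n f"
      using assms(2)[OF that] by (auto simp: graph_of_def)
    show "w = g m" if "(w, m) \<in> graph_of n f" for w
      using that assms(1) by (auto simp: graph_of_def)
  qed
qed

abbreviation diagonal :: "nat \<Rightarrow> (nat \<times> nat) set" where
  "diagonal n \<equiv> graph_of n (\<lambda>w. w)"

text \<open>A woman \<open>i < k\<close> and a man \<open>k + j\<close> with \<open>j < k\<close> encode the pair \<open>(i, j)\<close>; they
  like each other better than their diagonal partners iff \<open>(i, j)\<close> lies in both sets.
  If they elope, the woman \<open>k + j\<close> takes the man \<open>2 * k\<close>, which shifts all couples above \<open>2 * k\<close>
  by one; the last woman is left with the man \<open>i\<close>.\<close>

definition women_top :: "nat \<Rightarrow> nat \<Rightarrow> (nat \<times> nat) set \<Rightarrow> nat \<Rightarrow> nat list" where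
  "women_top n k x w =
    (if w < k then filter (\<lambda>m. (w, m - k) \<in> x) [k..<2*k] @ [w]
     else if w < 2 * k then [w, 2 * k]
     else if w < n - 1 then [w, w + 1]
     else (n - 1) # [0..<k])"

definition men_top :: "nat \<Rightarrow> nat \<Rightarrow> (nat \<times> nat) set \<Rightarrow> nat \<Rightarrow> nat list" where
  "men_top n k y m =
    (if m < k then [m, n - 1]
     else if m < 2 * k then filter (\<lambda>w. (w, m - k) \<in> y) [0..<k] @ [m]
     else if m = 2 * k then [k..<2*k] @ [2 * k]
     else [m - 1, m])"

definition women_profile :: "nat \<Rightarrow> nat \<Rightarrow> (nat \<times> nat) set \<Rightarrow> profile" where
  "women_profile n k x w = (if w < n then complete_list n (women_top n k x w) else [])"

definition men_profile :: "nat \<Rightarrow> nat \<Rightarrow> (nat \<times> nat) set \<Rightarrow> profile" where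
  "men_profile n k y m = (if m < n then complete_list n (men_top n k y m) else [])"

locale marriage_gadget =
  fixes n k :: nat and x y :: "(nat \<times> nat) set"
  assumes size: "2 * k < n"
begin

abbreviation "PW \<equiv> women_profile n k x"
abbreviation "PM \<equiv> men_profile n k y"

lemma valid_women: "valid_profile n PW"
proof -
  have "distinct (women_top n k x w)" "set (women_top n k x w) \<subseteq> {..<n}" if "w < n" for w
    using that size by (auto simp: women_top_def)
  then show ?thesis
    by (auto simp: valid_profile_def women_profile_def complete_list_perm)
qed

lemma valid_men: "valid_profile n PM"
proof -
  have "distinct (men_top n k y m)" "set (men_top n k y m) \<subseteq> {..<n}" if "m < n" for m
    using that size by (auto simp: men_top_def)
  then show ?thesis
    by (auto simp: valid_profile_def men_profile_def complete_list_perm)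
qed

section \<open>Preferences over the diagonal and the shifted partners\<close>

lemma better_PW: "w < n \<Longrightarrow> h \<in> set (women_top n k x w) \<Longrightarrow> better (PW w) h = better (women_top n k x w) h"
  by (simp add: women_profile_def better_complete_list)

lemma better_PM: "m < n \<Longrightarrow> g \<in> set (men_top n k y m) \<Longrightarrow> better (PM m) g = better (men_top n k y m) g"
  by (simp add: men_profile_def better_complete_list)

lemma better_women_diag: "w < n \<Longrightarrow> m \<in> better (PW w) w \<Longrightarrow> \<exists>j<k. w < k \<and> m = k + j \<and> (w, j) \<in> x"
proof -
  assume w: "w < n" and m: "m \<in> better (PW w) w"
  have top: "w \<in> set (women_top n k x w)" using w by (auto simp: women_top_def)
  have "w < k"
    using m w unfolding better_PW[OF w top] by (auto simp: women_top_def better_Cons split: if_splits)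
  then have "m \<in> set (filter (\<lambda>m. (w, m - k) \<in> x) [k..<2*k])"
    using m unfolding better_PW[OF w top] by (simp add: women_top_def better_snoc)
  then show ?thesis using \<open>w < k\<close> by (intro exI[of _ "m - k"]) auto
qed

lemma better_women_elope:
  assumes "i < k" "j < k" "(i, j) \<in> x" "m \<in> better (PW i) (k + j)"
  shows "\<exists>j'<k. j' \<noteq> j \<and> m = k + j' \<and> (i, j') \<in> x"
proof -
  let ?xs = "filter (\<lambda>m. (i, m - k) \<in> x) [k..<2*k]"
  have i: "i < n" using assms size by simp
  have kj: "k + j \<in> set ?xs" using assms by auto
  then have "better (PW i) (k + j) = better (?xs @ [i]) (k + j)"
    using assms i by (subst better_PW) (auto simp: women_top_def)
  then have "m \<in> set ?xs - {k + j}"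
    using assms(4) better_snoc_subset[OF kj] by auto
  then show ?thesis by (intro exI[of _ "m - k"]) auto
qed

lemma better_women_mid: "k \<le> w \<Longrightarrow> w < 2 * k \<Longrightarrow> better (PW w) (2 * k) = {w}"
  using size by (subst better_PW) (auto simp: women_top_def better_Cons better_def)

lemma better_women_shift: "2 * k \<le> w \<Longrightarrow> w < n - 1 \<Longrightarrow> better (PW w) (Suc w) = {w}"
  using size by (subst better_PW) (auto simp: women_top_def better_Cons better_def)

lemma better_women_last: "i < k \<Longrightarrow> better (PW (n - 1)) i \<subseteq> insert (n - 1) ({..<k} - {i})"
  using size better_subset[of "[0..<k]" i]
  by (subst better_PW) (auto simp: women_top_def better_Cons)

lemma better_men_diag: 
  assumes "m < n" "g \<in> better (PM m) m"
  shows "(k \<le> m \<and> m < 2 * k \<and> g < k \<and> (g, m - k) \<in> y) \<or> (m = 2 * k \<and> k \<le> g \<and> g < 2 * k) \<or> (2 * k < m \<and> g = m - 1)"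
proof -
  have top: "m \<in> set (men_top n k y m)" using assms by (auto simp: men_top_def)
  show ?thesis
    using assms unfolding better_PM[OF assms(1) top]
    by (auto simp: men_top_def better_Cons better_snoc better_def[of "[]"] split: if_splits)
qed

lemma better_men_elope:
  assumes "i < k" "j < k" "(i, j) \<in> y" "g \<in> better (PM (k + j)) i"
  shows "g < k \<and> g \<noteq> i \<and> (g, j) \<in> y"
proof -
  let ?xs = "filter (\<lambda>w. (w, j) \<in> y) [0..<k]"
  have kj: "k + j < n" using assms size by simp
  have i: "i \<in> set ?xs" using assms by auto
  then have "better (PM (k + j)) i = better (?xs @ [k + j]) i"
    using assms kj by (subst better_PM) (auto simp: men_top_def)
  then have "g \<in> set ?xs - {i}"
    using assms(4) better_snoc_subset[OF i] by auto
  then show ?thesis by auto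
qed

lemma better_men_low: "m < k \<Longrightarrow> better (PM m) (n - 1) = {m}"
  using size by (subst better_PM) (auto simp: men_top_def better_Cons better_def)

lemma better_men_mid: 
  assumes "j < k"
  shows "better (PM (2 * k)) (k + j) \<subseteq> {k..<2*k} - {k + j}"
proof -
  have "k + j \<in> set [k..<2*k]" using assms by auto
  from better_snoc_subset[OF this, of "2*k"] show ?thesis
    using assms size by (subst better_PM) (auto simp: men_top_def)
qed

lemma better_men_shift: "2 * k \<le> w \<Longrightarrow> w < n - 1 \<Longrightarrow> better (PM (Suc w)) w = {}"
  by (subst better_PM) (auto simp: men_top_def better_Cons)

text \<open>Woman \<open>k + j\<close> ranks man \<open>k + j\<close> first, and he prefers to her
  only women \<open>g\<close> with \<open>(g, j) \<in> y\<close>. Were he married to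
  \<open>i\<close>, the two would block.\<close>

lemma no_fake_elopement:
  assumes st: "stable n PW PM \<mu>" and ij: "i < k" "j < k" "(i, j) \<notin> y"
  shows "(i, k + j) \<notin> \<mu>"
proof
  assume mem: "(i, k + j) \<in> \<mu>"
  have p: "perfect n \<mu>" using st by (simp add: stable_def)
  have "(k + j, k + j) \<in> \<mu>"
  proof (rule stable_forced[OF st valid_women valid_men])
    show "k + j < n" "k + j < n" using ij size by auto
    show "h \<notin> better (PW (k + j)) (k + j)" for h
      using better_women_diag[of "k + j" h] ij size by auto
    show "g \<notin> better (PM (k + j)) (k + j)" if "(g, k + j) \<in> \<mu>" for g
      using better_men_diag[of "k + j" g] perfect_wife_unique[OF p mem that] ij size by auto
  qed
  then show False using perfect_wife_unique[OF p mem] ij by auto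
qed

text \<open>Man \<open>i\<close> ranks woman \<open>i\<close> first, and every man she prefers to
  him is excluded by \<open>no_fake_elopement\<close>.\<close>

lemma low_diag:
  assumes st: "stable n PW PM \<mu>" and i: "i < k" and dis: "\<And>j. (i, j) \<in> x \<Longrightarrow> (i, j) \<notin> y"
  shows "(i, i) \<in> \<mu>"
proof (rule stable_forced[OF st valid_women valid_men])
  show "i < n" "i < n" using i size by auto
  show "h \<notin> better (PW i) i" if "(i, h) \<in> \<mu>" for h
    using that better_women_diag[of i h] no_fake_elopement[OF st i] dis i size by force
  show "g \<notin> better (PM i) i" for g
    using better_men_diag[of i g] i size by auto
qed

text \<open>Woman \<open>k + j\<close> ranks man \<open>k + j\<close> first, and only women below
  \<open>k\<close> can beat her in his list.\<close>

lemma mid_diag: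
  assumes st: "stable n PW PM \<mu>" and j: "j < k"
    and no: "\<And>i. i < k \<Longrightarrow> (i, k + j) \<notin> \<mu>"
  shows "(k + j, k + j) \<in> \<mu>"
proof (rule stable_forced[OF st valid_women valid_men])
  show "k + j < n" "k + j < n" using j size by auto
  show "h \<notin> better (PW (k + j)) (k + j)" for h
    using better_women_diag[of "k + j" h] j size by auto
  show "g \<notin> better (PM (k + j)) (k + j)" if "(g, k + j) \<in> \<mu>" for g
    using better_men_diag[of "k + j" g] no[of g] that j size by auto
qed

lemma perfect_diagonal: "perfect n (diagonal n)"
  by (rule perfect_graph_of[where g="\<lambda>w. w"]) auto

text \<open>The diagonal couples are forced in increasing order: each woman from \<open>k\<close> on
  ranks her diagonal partner first, and the women he might prefer are already married to their own
  partners. Conversely, a pair blocking the diagonal would give an element of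
  \<open>x \<inter> y\<close>.\<close>

lemma stable_disjoint:
  assumes dis: "x \<inter> y = {}"
  shows "stable n PW PM \<mu> \<longleftrightarrow> \<mu> = diagonal n"
proof
  assume st: "stable n PW PM \<mu>"
  then have p: "perfect n \<mu>" by (simp add: stable_def)
  have low: "(i, i) \<in> \<mu>" if "i < k" for i
    using low_diag[OF st that] dis by auto
  have mid: "(k + j, k + j) \<in> \<mu>" if "j < k" for j
    using mid_diag[OF st that] perfect_husband_unique[OF p low] by fastforce
  have high: "2 * k + t < n \<Longrightarrow> (2 * k + t, 2 * k + t) \<in> \<mu>" for t
  proof (induction t)
    case 0
    show ?case
    proof (rule stable_forced[OF st valid_women valid_men])
      show "2 * k + 0 < n" "2 * k + 0 < n" using size by auto
      show "h \<notin> better (PW (2 * k + 0)) (2 * k + 0)" for h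
        using better_women_diag[of "2 * k" h] size by auto
      show "g \<notin> better (PM (2 * k + 0)) (2 * k + 0)" if g: "(g, 2 * k + 0) \<in> \<mu>" for g
      proof
        assume "g \<in> better (PM (2 * k + 0)) (2 * k + 0)"
        then have "k \<le> g" "g < 2 * k" using better_men_diag[of "2 * k" g] size by auto
        then have "(g, g) \<in> \<mu>" using mid[of "g - k"] by auto
        then show False using perfect_husband_unique[OF p g] \<open>g < 2 * k\<close> by auto
      qed
    qed
  next
    case (Suc t)
    then have IH: "(2 * k + t, 2 * k + t) \<in> \<mu>" by simp
    show ?case
    proof (rule stable_forced[OF st valid_women valid_men])
      show "2 * k + Suc t < n" "2 * k + Suc t < n" using Suc by auto
      show "h \<notin> better (PW (2 * k + Suc t)) (2 * k + Suc t)" for h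
        using better_women_diag[of "2 * k + Suc t" h] Suc by auto
      show "g \<notin> better (PM (2 * k + Suc t)) (2 * k + Suc t)" if "(g, 2 * k + Suc t) \<in> \<mu>" for g
        using better_men_diag[of "2 * k + Suc t" g] perfect_husband_unique[OF p IH, of "2 * k + Suc t"] that Suc.prems by auto
    qed
  qed
  have "(w, w) \<in> \<mu>" if "w < n" for w
    using low[of w] mid[of "w - k"] high[of "w - 2 * k"] that
    by (cases "w < k"; cases "w < 2 * k") auto
  then have "diagonal n \<subseteq> \<mu>" by (auto simp: graph_of_def)
  then show "\<mu> = diagonal n" using perfect_subset_eq[OF perfect_diagonal p] by simp
next
  assume [simp]: "\<mu> = diagonal n"
  show "stable n PW PM \<mu>"
  proof (rule stableI)
    show "perfect n \<mu>" using perfect_diagonal by simp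
    fix w m h g
    assume "(w, h) \<in> \<mu>" "(g, m) \<in> \<mu>" "m \<in> better (PW w) h" "w \<in> better (PM m) g"
    then have "w < n" "m < n" "m \<in> better (PW w) w" "w \<in> better (PM m) m"
      by (auto simp: graph_of_def)
    then show False
      using better_women_diag[of w m] better_men_diag[of m w] dis by auto
  qed
qed

definition shifted :: "nat \<Rightarrow> nat \<Rightarrow> nat \<Rightarrow> nat" where
  "shifted i j w = (if w = i then k + j else if w = k + j then 2 * k
     else if w < 2 * k then w else if w < n - 1 then Suc w else i)"

text \<open>For \<open>i, j < k\<close> this inverts \<open>shifted i j\<close> on the indices below
  \<open>n\<close>; it names the wife of each man.\<close>

definition unshifted :: "nat \<Rightarrow> nat \<Rightarrow> nat \<Rightarrow> nat" where
  "unshifted i j m = (if m = k + j then i else if m = 2 * k then k + j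
     else if m = i then n - 1 else if m < 2 * k then m else m - 1)"

lemma perfect_shifted: "i < k \<Longrightarrow> j < k \<Longrightarrow> perfect n (graph_of n (shifted i j))"
  using size by (intro perfect_graph_of[where g="unshifted i j"]) (auto simp: shifted_def unshifted_def)

text \<open>From \<open>2 * k\<close> on every woman has left her diagonal partner.\<close>

lemma card_diagonal_shifted:
  assumes "i < k" "j < k"
  shows "card (diagonal n \<inter> graph_of n (shifted i j)) \<le> 2 * k"
proof -
  have "diagonal n \<inter> graph_of n (shifted i j) \<subseteq> (\<lambda>w. (w, w)) ` {..<2*k}"
    using assms size by (auto simp: graph_of_def shifted_def split: if_splits)
  then have "card (diagonal n \<inter> graph_of n (shifted i j)) \<le> card ((\<lambda>w. (w, w)) ` {..<2*k})"
    by (intro card_mono) auto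
  also have "\<dots> \<le> 2 * k" using card_image_le[of "{..<2*k}" "\<lambda>w. (w, w)"] by simp
  finally show ?thesis .
qed

lemma woman_cases:
  "w < n \<Longrightarrow> w = i \<or> w = k + j \<or> (w < k \<and> w \<noteq> i) \<or> (k \<le> w \<and> w < 2 * k \<and> w \<noteq> k + j)
    \<or> (2 * k \<le> w \<and> w < n - 1) \<or> (2 * k \<le> w \<and> w = n - 1)"
  by auto

text \<open>Couples are forced along the chain: the other women below \<open>k\<close> stay, the
  eloping couple has no better option left, woman \<open>k + j0\<close> falls back on man
  \<open>2 * k\<close>, each later man gets the woman just before him, his favourite, and the last
  woman meets the abandoned man \<open>i0\<close>. For the converse, each woman is checked against
  the men she prefers.\<close>

lemma stable_meet:
  assumes meet: "x \<inter> y = {(i0, j0)}" and i0: "i0 < k" and j0: "j0 < k"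
  shows "stable n PW PM \<mu> \<longleftrightarrow> \<mu> = graph_of n (shifted i0 j0)"
proof
  assume st: "stable n PW PM \<mu>"
  then have p: "perfect n \<mu>" by (simp add: stable_def)
  note hu = perfect_husband_unique[OF p] and wu = perfect_wife_unique[OF p]
  have in0: "(i0, j0) \<in> x" "(i0, j0) \<in> y" using meet by auto
  have low: "(i, i) \<in> \<mu>" if "i < k" "i \<noteq> i0" for i
    using low_diag[OF st that(1)] that meet by auto
  have e: "(i0, k + j0) \<in> \<mu>"
  proof (rule stable_forced[OF st valid_women valid_men])
    show "i0 < n" "k + j0 < n" using i0 j0 size by auto
    show "h \<notin> better (PW i0) (k + j0)" if h: "(i0, h) \<in> \<mu>" for h
    proof
      assume "h \<in> better (PW i0) (k + j0)"
      \<comment> \<open>Woman \<open>i0\<close> may prefer other men \<open>k + j'\<close>, but then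
        \<open>(i0, j')\<close> lies outside \<open>y\<close>, since the intersection is a single
        point.\<close>
      then obtain j' where "j' < k" "j' \<noteq> j0" "h = k + j'" "(i0, j') \<in> x"
        using better_women_elope[OF i0 j0 in0(1)] by blast
      moreover from this have "(i0, j') \<notin> y" using meet by auto
      ultimately show False using no_fake_elopement[OF st i0] h by blast
    qed
    \<comment> \<open>Any rival of \<open>i0\<close> is another woman below \<open>k\<close>,
      already married on the diagonal.\<close>
    show "g \<notin> better (PM (k + j0)) i0" if g: "(g, k + j0) \<in> \<mu>" for g
      using better_men_elope[OF i0 j0 in0(2), of g] low[of g] hu[OF g, of g] by auto
  qed
  have mid: "(k + j, k + j) \<in> \<mu>" if j: "j < k" "j \<noteq> j0" for j
  proof (rule mid_diag[OF st j(1)])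
    show "(i, k + j) \<notin> \<mu>" if "i < k" for i
      using hu[of i "k + j" "k + j0"] hu[of i "k + j" i] e low[of i] j that by fastforce
  qed
  have d: "(k + j0, 2 * k) \<in> \<mu>"
  proof (rule stable_forced[OF st valid_women valid_men])
    show "k + j0 < n" "2 * k < n" using j0 size by auto
    show "h \<notin> better (PW (k + j0)) (2 * k)" if h: "(k + j0, h) \<in> \<mu>" for h
      using better_women_mid[of "k + j0"] wu[OF e, of "k + j0"] h j0 i0 by auto
    show "g \<notin> better (PM (2 * k)) (k + j0)" if g: "(g, 2 * k) \<in> \<mu>" for g
    proof
      assume "g \<in> better (PM (2 * k)) (k + j0)"
      then have *: "k \<le> g" "g < 2 * k" "g \<noteq> k + j0" using better_men_mid[OF j0] by auto
      then have "(g, g) \<in> \<mu>" using mid[of "g - k"] by auto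
      then show False using hu[OF g] * by auto
    qed
  qed
  have high: "2 * k + t < n - 1 \<Longrightarrow> (2 * k + t, Suc (2 * k + t)) \<in> \<mu>" for t
  proof (induction t)
    case 0
    show ?case
    proof (rule stable_forced[OF st valid_women valid_men])
      show "2 * k + 0 < n" "Suc (2 * k + 0) < n" using 0 by auto
      show "h \<notin> better (PW (2 * k + 0)) (Suc (2 * k + 0))" if h: "(2 * k + 0, h) \<in> \<mu>" for h
        using better_women_shift[of "2 * k"] wu[OF d, of "2 * k"] h 0 j0 by auto
      show "g \<notin> better (PM (Suc (2 * k + 0))) (2 * k + 0)" for g
        using better_men_shift[of "2 * k"] 0 by auto
    qed
  next
    case (Suc t)
    then have IH: "(2 * k + t, 2 * k + Suc t) \<in> \<mu>" by simp
    show ?case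
    proof (rule stable_forced[OF st valid_women valid_men])
      show "2 * k + Suc t < n" "Suc (2 * k + Suc t) < n" using Suc.prems by auto
      show "h \<notin> better (PW (2 * k + Suc t)) (Suc (2 * k + Suc t))" if h: "(2 * k + Suc t, h) \<in> \<mu>" for h
      proof
        assume "h \<in> better (PW (2 * k + Suc t)) (Suc (2 * k + Suc t))"
        moreover have "better (PW (2 * k + Suc t)) (Suc (2 * k + Suc t)) = {2 * k + Suc t}"
          using Suc.prems by (intro better_women_shift) auto
        ultimately have "h = 2 * k + Suc t" by (simp only: singleton_iff)
        from wu[OF IH h[unfolded this]] show False by simp
      qed
      show "g \<notin> better (PM (Suc (2 * k + Suc t))) (2 * k + Suc t)" for g
        using better_men_shift[of "2 * k + Suc t"] Suc.prems by auto
    qed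
  qed
  have last: "(n - 1, i0) \<in> \<mu>"
  proof (rule stable_forced[OF st valid_women valid_men])
    show "n - 1 < n" "i0 < n" using i0 size by auto
    show "h \<notin> better (PW (n - 1)) i0" if h: "(n - 1, h) \<in> \<mu>" for h
    proof
      assume "h \<in> better (PW (n - 1)) i0"
      then consider "h = n - 1" | "h < k" "h \<noteq> i0" using better_women_last[OF i0] by auto
      then show False
      proof cases
        case 1
        \<comment> \<open>Man \<open>n - 1\<close> is taken by woman \<open>k + j0\<close> if he is
          man \<open>2 * k\<close>, and by woman \<open>n - 2\<close> otherwise.\<close>
        show False
        proof (cases "n - 1 = 2 * k")
          case True
          then show False using wu[OF d, of "2 * k"] h 1 j0 by auto
        next
          case False
          then have "(n - 2, n - 1) \<in> \<mu>"
            using high[of "n - 2 - 2 * k"] size by (auto simp: Suc_diff_Suc numeral_2_eq_2)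
          then show False using wu[of "n - 2" "n - 1" "n - 1"] h 1 size i0 by auto
        qed
      next
        case 2
        then show False using wu[OF low h] size by auto
      qed
    qed
    show "g \<notin> better (PM i0) (n - 1)" if g: "(g, i0) \<in> \<mu>" for g
      using better_men_low[OF i0] hu[OF e, of i0] g i0 by auto
  qed
  have "(w, shifted i0 j0 w) \<in> \<mu>" if "w < n" for w
  proof -
    consider "w = i0" | "w = k + j0" | "w < k" "w \<noteq> i0" | "k \<le> w" "w < 2 * k" "w \<noteq> k + j0"
      | "2 * k \<le> w" "w < n - 1" | "2 * k \<le> w" "w = n - 1"
      using woman_cases[OF \<open>w < n\<close>, of i0 j0] by blast
    then show ?thesis
    proof cases
      case 4
      then show ?thesis using mid[of "w - k"] i0 j0 by (auto simp: shifted_def)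
    next
      case 5
      then show ?thesis using high[of "w - 2 * k"] i0 j0 by (auto simp: shifted_def)
    qed (use e d low last i0 j0 size in \<open>auto simp: shifted_def\<close>)
  qed
  then have "graph_of n (shifted i0 j0) \<subseteq> \<mu>" by (auto simp: graph_of_def)
  then show "\<mu> = graph_of n (shifted i0 j0)"
    using perfect_subset_eq[OF perfect_shifted[OF i0 j0] p] by simp
next
  assume \<mu>: "\<mu> = graph_of n (shifted i0 j0)"
  have in0: "(i0, j0) \<in> x" "(i0, j0) \<in> y" using meet by auto
  have p: "perfect n \<mu>" using \<mu> perfect_shifted[OF i0 j0] by simp
  show "stable n PW PM \<mu>"
  proof (rule stableI[OF p])
    fix w m h g
    assume wh: "(w, h) \<in> \<mu>" and gm: "(g, m) \<in> \<mu>"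
      and m: "m \<in> better (PW w) h" and w: "w \<in> better (PM m) g"
    have lt: "w < n" "g < n" and h: "h = shifted i0 j0 w" and mg: "m = shifted i0 j0 g"
      using wh gm by (auto simp: \<mu> graph_of_def)
    \<comment> \<open>Through the inverse, each case for \<open>w\<close> and \<open>m\<close>
      determines the present wife \<open>g\<close> of \<open>m\<close>.\<close>
    have wife: "g = unshifted i0 j0 m"
      using mg lt i0 j0 size by (auto simp: shifted_def unshifted_def)
    have mn: "m < n" using gm p by (auto simp: perfect_def)
    consider "w = i0" | "w = k + j0" | "w < k" "w \<noteq> i0" | "k \<le> w" "w < 2 * k" "w \<noteq> k + j0"
      | "2 * k \<le> w" "w < n - 1" | "2 * k \<le> w" "w = n - 1"
      using woman_cases[OF lt(1), of i0 j0] by blast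
    then show False
    proof cases
      case 1
      then have "m \<in> better (PW i0) (k + j0)" using m h by (simp add: shifted_def)
      then obtain j' where j': "j' < k" "j' \<noteq> j0" "m = k + j'" "(i0, j') \<in> x"
        using better_women_elope[OF i0 j0 in0(1)] by blast
      then have "g = m" using wife i0 by (simp add: unshifted_def)
      then have "(i0, j') \<in> y" using better_men_diag[OF mn, of w] w 1 j' by auto
      then show False using j' meet by auto
    next
      case 2
      then have "m = k + j0" using m h better_women_mid[of "k + j0"] i0 j0 by (simp add: shifted_def)
      then have "g = i0" using wife by (simp add: unshifted_def)
      then show False using better_men_elope[OF i0 j0 in0(2), of w] w 2 \<open>m = k + j0\<close> by auto
    next
      case 3
      then have "m \<in> better (PW w) w" using m h j0 by (simp add: shifted_def)
      then obtain j where j: "j < k" "m = k + j" "(w, j) \<in> x"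
        using better_women_diag[OF lt(1)] by blast
      have "(w, j) \<in> y"
      proof (cases "j = j0")
        case True
        then have "g = i0" using wife j by (simp add: unshifted_def)
        then show ?thesis using better_men_elope[OF i0 j0 in0(2), of w] w True j by auto
      next
        case False
        then have "g = m" using wife i0 j by (simp add: unshifted_def)
        then show ?thesis using better_men_diag[OF mn, of w] w j by auto
      qed
      then show False using j meet 3 by auto
    next
      case 4
      then have "m \<in> better (PW w) w" using m h i0 by (simp add: shifted_def)
      then show False using better_women_diag[OF lt(1)] 4 by auto
    next
      case 5
      then have mw: "m = w" using m h better_women_shift[of w] i0 j0 by (simp add: shifted_def)
      show False
      proof (cases "w = 2 * k")
        case True
        then have "g = k + j0" using wife mw j0 by (simp add: unshifted_def)
        then show False using w better_men_mid[OF j0] mw True by auto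
      next
        case False
        then have "g = w - 1" "2 * k < w" using wife mw 5 i0 j0 by (simp_all add: unshifted_def)
        then show False using w better_men_shift[of "w - 1"] mw 5 by auto
      qed
    next
      case 6
      then have "m \<in> better (PW (n - 1)) i0" using m h i0 j0 by (simp add: shifted_def)
      then consider "m = n - 1" | "m < k" "m \<noteq> i0" using better_women_last[OF i0] by auto
      then show False
      proof cases
        case 1
        show False
        proof (cases "w = 2 * k")
          case True
          then have "g = k + j0" using wife 1 6 j0 by (simp add: unshifted_def)
          then show False using w better_men_mid[OF j0] 1 6 True by auto
        next
          case False
          then have "g = w - 1" "2 * k < w" using wife 1 6 i0 j0 by (simp_all add: unshifted_def)
          then have "better (PM (Suc (w - 1))) (w - 1) = {}" "Suc (w - 1) = m"
            using 1 6 by (auto intro!: better_men_shift)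
          then show False using w \<open>g = w - 1\<close> by (simp only: empty_iff)
        qed
      next
        case 2
        then have "g = m" using wife by (simp add: unshifted_def)
        then show False using better_men_diag[OF mn, of w] w 2 by auto
      qed
    qed
  qed
qed

end

subsection \<open>Lower bounds for stable marriage problems\<close>

text \<open>The common reduction: \<open>a n\<close> is the parameter handed to the algorithm, and
  \<open>g n\<close> is the test by which an answer reveals disjointness. The constant
  \<open>\<delta>\<close> is chosen so that the at most \<open>2 * k\<close> diagonal couples
  surviving a shift are too few to mislead the test.\<close>

lemma query_lower_bound_sqI:
  fixes Dom :: "nat \<Rightarrow> 'x \<Rightarrow> profile \<Rightarrow> profile \<Rightarrow> bool"
    and R :: "nat \<Rightarrow> 'x \<Rightarrow> profile \<Rightarrow> profile \<Rightarrow> 'o \<Rightarrow> bool"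
    and a :: "nat \<Rightarrow> 'x" and g :: "nat \<Rightarrow> 'o \<Rightarrow> bool"
  assumes \<delta>: "0 < \<delta>" "\<delta> \<le> 1"
    and disj: "\<And>n k x y. 2 * k < n \<Longrightarrow> real (2 * k) < \<delta> * real n \<Longrightarrow> x \<inter> y = {} \<Longrightarrow>
        Dom n (a n) (women_profile n k x) (men_profile n k y) \<and>
        (\<forall>r. R n (a n) (women_profile n k x) (men_profile n k y) r \<longrightarrow> g n r)"
    and meet: "\<And>n k x y i j. 2 * k < n \<Longrightarrow> real (2 * k) < \<delta> * real n \<Longrightarrow> i < k \<Longrightarrow> j < k \<Longrightarrow> x \<inter> y = {(i, j)} \<Longrightarrow>
        Dom n (a n) (women_profile n k x) (men_profile n k y) \<and>
        (\<forall>r. R n (a n) (women_profile n k x) (men_profile n k y) r \<longrightarrow> \<not> g n r)"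
  shows "query_lower_bound_sq Dom R"
proof -
  define \<kappa> where "\<kappa> = ln bias_base / 100 * (\<delta> / 8)\<^sup>2"
  have \<kappa>: "\<kappa> > 0" using \<delta> bias_base_gt_1 by (simp add: \<kappa>_def)
  \<comment> \<open>The bound \<open>8 / \<delta>\<close> makes the rounding of \<open>k\<close>
    cost at most a factor 2, and \<open>12 / \<kappa>\<close> lets the additive 6 consume at most
    half of the quadratic term.\<close>
  define N0 where "N0 = nat \<lceil>max (8 / \<delta>) (12 / \<kappa>)\<rceil> + 1"
  have "\<kappa> / 2 * (real n)\<^sup>2 \<le> real q"
    if n: "n \<ge> N0" and solves: "rand_solves n (Dom n) (R n) A" and bnd: "query_bounded n (Dom n) q A"
    for n q and A :: "'x \<Rightarrow> 'o qtree pmf"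
  proof -
    have "max (8 / \<delta>) (12 / \<kappa>) \<le> real n" "n \<ge> 1"
      using n unfolding N0_def by linarith+
    then have n8: "8 \<le> \<delta> * n" and n12: "12 \<le> \<kappa> * n" and n1: "real n \<ge> 1"
      using \<delta> \<kappa> by (auto simp: field_simps)
    define k where "k = nat \<lfloor>\<delta> * n / 4\<rfloor>"
    have k: "real k \<le> \<delta> * n / 4" "real k \<ge> \<delta> * n / 4 - 1"
    proof -
      have "real k = of_int \<lfloor>\<delta> * n / 4\<rfloor>" using \<delta> by (simp add: k_def)
      then show "real k \<le> \<delta> * n / 4" "real k \<ge> \<delta> * n / 4 - 1" by linarith+
    qed
    have k\<delta>: "real (2 * k) < \<delta> * n" using k n8 by simp
    also have "\<delta> * n \<le> real n" using \<delta> by (simp add: mult_left_le_one_le)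
    finally have kn: "2 * k < n" by simp
    define I where "I = {..<k} \<times> {..<k}"
    have valid: "valid_profile n (women_profile n k x)" "valid_profile n (men_profile n k x)" for x
      using marriage_gadget.valid_women[of n k x] marriage_gadget.valid_men[of n k x] kn
      by (auto simp: marriage_gadget_def)
    have "ln bias_base / 100 * real (card I) \<le> real q + 6"
    proof (rule disjointness_lower_bound[where D = "A (a n)" and F = "women_profile n k" and G = "men_profile n k" and g = "g n"])
      show "finite I" by (simp add: I_def)
    next
      fix x y T
      assume xy: "x \<subseteq> I" "y \<subseteq> I" "x \<inter> y = {} \<or> (\<exists>i\<in>I. x \<inter> y = {i})" and T: "T \<in> set_pmf (A (a n))"
      have "Dom n (a n) (women_profile n k x) (men_profile n k y)"
        using xy(3) disj[OF kn k\<delta>] meet[OF kn k\<delta>] by (auto simp: I_def)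
      then show "queries T (women_profile n k x) (men_profile n k y) \<le> q"
        using bnd valid T unfolding query_bounded_def by blast
    next
      fix x y :: "(nat \<times> nat) set"
      assume d: "x \<inter> y = {}"
      have "2/3 \<le> measure_pmf.prob (A (a n))
          {T. R n (a n) (women_profile n k x) (men_profile n k y) (run T (women_profile n k x) (men_profile n k y))}"
        using solves valid disj[OF kn k\<delta> d] unfolding rand_solves_def by blast
      also have "\<dots> \<le> measure_pmf.prob (A (a n)) {T. g n (run T (women_profile n k x) (men_profile n k y))}"
        using disj[OF kn k\<delta> d] by (intro measure_pmf.finite_measure_mono) auto
      finally show "2/3 \<le> measure_pmf.prob (A (a n)) {T. g n (run T (women_profile n k x) (men_profile n k y))}" .
    next
      fix x y :: "(nat \<times> nat) set" and i
      assume i: "i \<in> I" "x \<inter> y = {i}"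
      obtain i1 i2 where i12: "i = (i1, i2)" "i1 < k" "i2 < k" using i by (auto simp: I_def)
      note m = meet[OF kn k\<delta> i12(2,3), of x y]
      have "2/3 \<le> measure_pmf.prob (A (a n))
          {T. R n (a n) (women_profile n k x) (men_profile n k y) (run T (women_profile n k x) (men_profile n k y))}"
        using solves valid m i i12 unfolding rand_solves_def by blast
      also have "\<dots> \<le> measure_pmf.prob (A (a n)) {T. \<not> g n (run T (women_profile n k x) (men_profile n k y))}"
        using m i i12 by (intro measure_pmf.finite_measure_mono) auto
      finally show "2/3 \<le> measure_pmf.prob (A (a n)) {T. \<not> g n (run T (women_profile n k x) (men_profile n k y))}" .
    qed
    moreover have "ln bias_base / 100 * (\<delta> / 8 * n)\<^sup>2 \<le> ln bias_base / 100 * real (card I)"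
    proof (rule mult_left_mono)
      have "\<delta> / 8 * n \<le> real k" using k n8 by simp
      then have "(\<delta> / 8 * n)\<^sup>2 \<le> (real k)\<^sup>2" using \<delta> by (intro power_mono) auto
      then show "(\<delta> / 8 * n)\<^sup>2 \<le> real (card I)" by (simp add: I_def power2_eq_square)
    qed (use bias_base_gt_1 in auto)
    moreover have "\<kappa> * (real n)\<^sup>2 = ln bias_base / 100 * (\<delta> / 8 * n)\<^sup>2"
      by (simp only: \<kappa>_def power_mult_distrib mult.assoc)
    ultimately have "\<kappa> * (real n)\<^sup>2 \<le> real q + 6"
      by linarith
    moreover have "12 \<le> \<kappa> * (real n)\<^sup>2"
    proof -
      have "\<kappa> * real n * 1 \<le> \<kappa> * real n * real n" using n1 \<kappa> by (intro mult_left_mono) auto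
      then show ?thesis using n12 by (simp add: power2_eq_square mult_ac)
    qed
    ultimately show ?thesis by simp
  qed
  then show ?thesis
    unfolding query_lower_bound_sq_def using \<kappa> by (intro exI[of _ "\<kappa> / 2"] conjI exI[of _ N0]) auto
qed

lemma dist_stable_unique:
  assumes "\<And>\<mu>'. stable n pW pM \<mu>' \<longleftrightarrow> \<mu>' = \<nu>"
  shows "dist_stable n pW pM \<mu> = n - card (\<mu> \<inter> \<nu>)"
  using assms by (simp add: dist_stable_def divorce_dist_def)

lemma card_graph_of: "card (graph_of n f) = n"
proof -
  have "graph_of n f = (\<lambda>w. (w, f w)) ` {..<n}" by (auto simp: graph_of_def)
  then show ?thesis by (simp add: card_image inj_on_def)
qed

lemma finite_graph_of: "finite (graph_of n f)"
  by (simp add: graph_of_def)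

lemma perfect_card:
  assumes "perfect n \<mu>"
  shows "finite \<mu>" "card \<mu> \<le> n"
proof -
  show "finite \<mu>" using assms finite_subset[of \<mu> "{..<n} \<times> {..<n}"] by (simp add: perfect_def)
  have "inj_on fst \<mu>" using perfect_husband_unique[OF assms] by (auto simp: inj_on_def)
  then have "card \<mu> = card (fst ` \<mu>)" by (simp add: card_image)
  also have "\<dots> \<le> card {..<n}" using assms by (intro card_mono) (auto simp: perfect_def)
  finally show "card \<mu> \<le> n" by simp
qed

text \<open>For disjoint sets an answer shares at least \<open>(1 - \<epsilon>) * n\<close> couples
  with the diagonal. Otherwise at most \<open>\<epsilon> * n\<close> of its couples lie outside the
  shifted marriage, so it shares at most \<open>2 * k + \<epsilon> * n\<close> with the diagonal. A
  gap between the two requires \<open>\<epsilon> < 1/2\<close>.\<close>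

lemma find_almost_stable_lower_bound:
  assumes "0 \<le> \<epsilon>" "\<epsilon> < 1/2"
  shows "query_lower_bound_sq (\<lambda>n (x::unit) pW pM. True)
      (\<lambda>n x pW pM \<mu>. perfect n \<mu> \<and> almost_stable \<epsilon> n pW pM \<mu>)"
proof (rule query_lower_bound_sqI[where \<delta> = "1 - 2 * \<epsilon>" and g = "\<lambda>n \<mu>. (1 - \<epsilon>) * real n \<le> real (card (\<mu> \<inter> diagonal n))"])
  fix n k :: nat and x y :: "(nat \<times> nat) set"
  assume k: "2 * k < n" "real (2 * k) < (1 - 2 * \<epsilon>) * real n"
  interpret marriage_gadget n k x y by unfold_locales fact
  {
    assume "x \<inter> y = {}"
    note dist_stable_unique[OF stable_disjoint[OF this]]
    then show "True \<and> (\<forall>\<mu>. perfect n \<mu> \<and> almost_stable \<epsilon> n PW PM \<mu>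
        \<longrightarrow> (1 - \<epsilon>) * real n \<le> real (card (\<mu> \<inter> diagonal n)))"
      by (auto simp: almost_stable_def algebra_simps)
  next
    fix i j assume ij: "i < k" "j < k" "x \<inter> y = {(i, j)}"
    let ?S = "graph_of n (shifted i j)"
    show "True \<and> (\<forall>\<mu>. perfect n \<mu> \<and> almost_stable \<epsilon> n PW PM \<mu>
        \<longrightarrow> \<not> (1 - \<epsilon>) * real n \<le> real (card (\<mu> \<inter> diagonal n)))"
    proof (intro conjI TrueI allI impI; elim conjE)
      fix \<mu> assume p: "perfect n \<mu>" and a: "almost_stable \<epsilon> n PW PM \<mu>"
      have near: "real (n - card (\<mu> \<inter> ?S)) \<le> \<epsilon> * n"
        using a dist_stable_unique[OF stable_meet[OF ij(3,1,2)], of \<mu>] by (simp add: almost_stable_def)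
      have "card (\<mu> \<inter> diagonal n) \<le> card (diagonal n \<inter> ?S \<union> (\<mu> - ?S))"
        using perfect_card[OF p] by (intro card_mono) (auto simp: finite_graph_of)
      also have "\<dots> \<le> card (diagonal n \<inter> ?S) + card (\<mu> - ?S)" by (rule card_Un_le)
      also have "\<dots> \<le> 2 * k + (n - card (\<mu> \<inter> ?S))"
        using card_diagonal_shifted[OF ij(1,2)] perfect_card[OF p]
        by (intro add_mono) (auto simp: card_Diff_subset_Int)
      finally have "real (card (\<mu> \<inter> diagonal n)) \<le> real (2 * k) + real (n - card (\<mu> \<inter> ?S))"
        by (metis of_nat_add of_nat_le_iff)
      then show "\<not> (1 - \<epsilon>) * real n \<le> real (card (\<mu> \<inter> diagonal n))"
        using near k(2) by (simp add: algebra_simps)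
    qed
  }
qed (use assms in auto)

text \<open>The diagonal is the given marriage: it is stable, or it shares at most
  \<open>2 * k\<close> couples with the only stable marriage and is thus more than
  \<open>\<epsilon> * n\<close> away.\<close>

lemma verify_stable_lower_bound:
  assumes "0 \<le> \<epsilon>" "\<epsilon> < 1"
  shows "query_lower_bound_sq
      (\<lambda>n \<mu> pW pM. perfect n \<mu> \<and> (stable n pW pM \<mu> \<or> eps_unstable \<epsilon> n pW pM \<mu>))
      (\<lambda>n \<mu> pW pM b. b = stable n pW pM \<mu>)"
proof (rule query_lower_bound_sqI[where \<delta> = "1 - \<epsilon>" and a = diagonal and g = "\<lambda>n b. b"])
  fix n k :: nat and x y :: "(nat \<times> nat) set"
  assume k: "2 * k < n" "real (2 * k) < (1 - \<epsilon>) * real n"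
  interpret marriage_gadget n k x y by unfold_locales fact
  {
    assume "x \<inter> y = {}"
    then show "(perfect n (diagonal n) \<and> (stable n PW PM (diagonal n) \<or> eps_unstable \<epsilon> n PW PM (diagonal n)))
        \<and> (\<forall>b. b = stable n PW PM (diagonal n) \<longrightarrow> b)"
      by (simp add: stable_disjoint perfect_diagonal)
  next
    fix i j assume ij: "i < k" "j < k" "x \<inter> y = {(i, j)}"
    let ?S = "graph_of n (shifted i j)"
    have "real n - real (2 * k) \<le> real (n - card (diagonal n \<inter> ?S))"
      using card_diagonal_shifted[OF ij(1,2)] by linarith
    then have "eps_unstable \<epsilon> n PW PM (diagonal n)"
      using dist_stable_unique[OF stable_meet[OF ij(3,1,2)], of "diagonal n"] k(2)
      by (simp add: eps_unstable_def algebra_simps)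
    moreover have "diagonal n \<noteq> ?S"
      using card_diagonal_shifted[OF ij(1,2)] card_graph_of[of n "\<lambda>w. w"] k(1) by fastforce
    ultimately show "(perfect n (diagonal n) \<and> (stable n PW PM (diagonal n) \<or> eps_unstable \<epsilon> n PW PM (diagonal n)))
        \<and> (\<forall>b. b = stable n PW PM (diagonal n) \<longrightarrow> \<not> b)"
      using stable_meet[OF ij(3,1,2)] perfect_diagonal by simp
  }
qed (use assms in auto)

lemma (in marriage_gadget) last_pair_not_shifted:
  assumes "i < k" "j < k"
  shows "(n - 1, n - 1) \<notin> graph_of n (shifted i j)"
  using assms size by (auto simp: graph_of_def shifted_def)

text \<open>The couple \<open>(n - 1, n - 1)\<close> is on the diagonal but in no shifted marriage.
  As the stable marriage is unique, the same couple also serves the version for every stable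
  marriage.\<close>

lemma pair_in_some_lower_bound:
  "query_lower_bound_sq (\<lambda>n (w, m) pW pM. w < n \<and> m < n)
      (\<lambda>n (w, m) pW pM b. b = (\<exists>\<mu>. stable n pW pM \<mu> \<and> (w, m) \<in> \<mu>))"
proof (rule query_lower_bound_sqI[where \<delta> = 1 and a = "\<lambda>n. (n - 1, n - 1)" and g = "\<lambda>n b. b"])
  fix n k :: nat and x y :: "(nat \<times> nat) set"
  assume k: "2 * k < n"
  interpret marriage_gadget n k x y by unfold_locales fact
  {
    assume "x \<inter> y = {}"
    then show "(case (n - 1, n - 1) of (w, m) \<Rightarrow> \<lambda>pW pM. w < n \<and> m < n) PW PM \<and>
        (\<forall>r. (case (n - 1, n - 1) of (w, m) \<Rightarrow> \<lambda>pW pM b. b = (\<exists>\<mu>. stable n pW pM \<mu> \<and> (w, m) \<in> \<mu>)) PW PM r \<longrightarrow> r)"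
      using k by (simp add: stable_disjoint graph_of_def)
  next
    fix i j assume ij: "i < k" "j < k" "x \<inter> y = {(i, j)}"
    then show "(case (n - 1, n - 1) of (w, m) \<Rightarrow> \<lambda>pW pM. w < n \<and> m < n) PW PM \<and>
        (\<forall>r. (case (n - 1, n - 1) of (w, m) \<Rightarrow> \<lambda>pW pM b. b = (\<exists>\<mu>. stable n pW pM \<mu> \<and> (w, m) \<in> \<mu>)) PW PM r \<longrightarrow> \<not> r)"
      using k last_pair_not_shifted[OF ij(1,2)] by (simp add: stable_meet)
  }
qed auto

lemma pair_in_every_lower_bound:
  "query_lower_bound_sq (\<lambda>n (w, m) pW pM. w < n \<and> m < n)
      (\<lambda>n (w, m) pW pM b. b = (\<forall>\<mu>. stable n pW pM \<mu> \<longrightarrow> (w, m) \<in> \<mu>))"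
proof (rule query_lower_bound_sqI[where \<delta> = 1 and a = "\<lambda>n. (n - 1, n - 1)" and g = "\<lambda>n b. b"])
  fix n k :: nat and x y :: "(nat \<times> nat) set"
  assume k: "2 * k < n"
  interpret marriage_gadget n k x y by unfold_locales fact
  {
    assume "x \<inter> y = {}"
    then show "(case (n - 1, n - 1) of (w, m) \<Rightarrow> \<lambda>pW pM. w < n \<and> m < n) PW PM \<and>
        (\<forall>r. (case (n - 1, n - 1) of (w, m) \<Rightarrow> \<lambda>pW pM b. b = (\<forall>\<mu>. stable n pW pM \<mu> \<longrightarrow> (w, m) \<in> \<mu>)) PW PM r \<longrightarrow> r)"
      using k by (simp add: stable_disjoint graph_of_def)
  next
    fix i j assume ij: "i < k" "j < k" "x \<inter> y = {(i, j)}"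
    then show "(case (n - 1, n - 1) of (w, m) \<Rightarrow> \<lambda>pW pM. w < n \<and> m < n) PW PM \<and>
        (\<forall>r. (case (n - 1, n - 1) of (w, m) \<Rightarrow> \<lambda>pW pM b. b = (\<forall>\<mu>. stable n pW pM \<mu> \<longrightarrow> (w, m) \<in> \<mu>)) PW PM r \<longrightarrow> \<not> r)"
      using k last_pair_not_shifted[OF ij(1,2)] by (simp add: stable_meet)
  }
qed auto

lemma (in marriage_gadget) card_inter_diagonal:
  assumes "i < k" "j < k" "S \<subseteq> graph_of n (shifted i j)"
  shows "card (S \<inter> diagonal n) \<le> 2 * k"
proof -
  have "card (S \<inter> diagonal n) \<le> card (diagonal n \<inter> graph_of n (shifted i j))"
    using assms(3) by (intro card_mono) (auto simp: finite_graph_of)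
  then show ?thesis using card_diagonal_shifted[OF assms(1,2)] by simp
qed

text \<open>A correct answer lies inside the unique stable marriage: its pairs are all diagonal in
  one case, and at most \<open>2 * k\<close> of them are in the other, which is less than
  \<open>\<epsilon> * n\<close>.\<close>

lemma find_pairs_in_some_lower_bound:
  assumes "0 < \<epsilon>" "\<epsilon> \<le> 1"
  shows "query_lower_bound_sq (\<lambda>n (x::unit) pW pM. True)
        (\<lambda>n x pW pM S. finite S \<and> real (card S) \<ge> \<epsilon> * real n
           \<and> (\<forall>p\<in>S. \<exists>\<mu>. stable n pW pM \<mu> \<and> p \<in> \<mu>))"
proof (rule query_lower_bound_sqI[where \<delta> = \<epsilon> and g = "\<lambda>n S. \<epsilon> * real n \<le> real (card (S \<inter> diagonal n))"])
  fix n k :: nat and x y :: "(nat \<times> nat) set"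
  assume k: "2 * k < n" "real (2 * k) < \<epsilon> * real n"
  interpret marriage_gadget n k x y by unfold_locales fact
  {
    assume "x \<inter> y = {}"
    then show "True \<and> (\<forall>S. finite S \<and> real (card S) \<ge> \<epsilon> * real n
           \<and> (\<forall>p\<in>S. \<exists>\<mu>. stable n PW PM \<mu> \<and> p \<in> \<mu>) \<longrightarrow> \<epsilon> * real n \<le> real (card (S \<inter> diagonal n)))"
      by (auto simp: stable_disjoint subset_eq[symmetric] Int_absorb2)
  next
    fix i j assume ij: "i < k" "j < k" "x \<inter> y = {(i, j)}"
    show "True \<and> (\<forall>S. finite S \<and> real (card S) \<ge> \<epsilon> * real n
           \<and> (\<forall>p\<in>S. \<exists>\<mu>. stable n PW PM \<mu> \<and> p \<in> \<mu>) \<longrightarrow> \<not> \<epsilon> * real n \<le> real (card (S \<inter> diagonal n)))"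
      using k(2) card_inter_diagonal[OF ij(1,2)] stable_meet[OF ij(3,1,2)]
      by (fastforce simp: subset_eq)
  }
qed (use assms in auto)

text \<open>The promise holds in both kinds of market because the unique stable marriage has
  \<open>n\<close> couples.\<close>

lemma find_pairs_in_every_lower_bound:
  assumes "0 < \<epsilon>" "\<epsilon> \<le> 1"
  shows "query_lower_bound_sq
        (\<lambda>n (x::unit) pW pM. real (card {p. \<forall>\<mu>. stable n pW pM \<mu> \<longrightarrow> p \<in> \<mu>}) \<ge> \<epsilon> * real n)
        (\<lambda>n x pW pM S. finite S \<and> real (card S) \<ge> \<epsilon> * real n
           \<and> (\<forall>p\<in>S. \<forall>\<mu>. stable n pW pM \<mu> \<longrightarrow> p \<in> \<mu>))"
proof (rule query_lower_bound_sqI[where \<delta> = \<epsilon> and g = "\<lambda>n S. \<epsilon> * real n \<le> real (card (S \<inter> diagonal n))"])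
  fix n k :: nat and x y :: "(nat \<times> nat) set"
  assume k: "2 * k < n" "real (2 * k) < \<epsilon> * real n"
  interpret marriage_gadget n k x y by unfold_locales fact
  have n: "\<epsilon> * real n \<le> real n" using assms by (simp add: mult_left_le_one_le)
  {
    assume "x \<inter> y = {}"
    then show "\<epsilon> * real n \<le> real (card {p. \<forall>\<mu>. stable n PW PM \<mu> \<longrightarrow> p \<in> \<mu>}) \<and>
        (\<forall>S. finite S \<and> real (card S) \<ge> \<epsilon> * real n
           \<and> (\<forall>p\<in>S. \<forall>\<mu>. stable n PW PM \<mu> \<longrightarrow> p \<in> \<mu>) \<longrightarrow> \<epsilon> * real n \<le> real (card (S \<inter> diagonal n)))"
      using n by (auto simp: stable_disjoint card_graph_of subset_eq[symmetric] Int_absorb2)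
  next
    fix i j assume ij: "i < k" "j < k" "x \<inter> y = {(i, j)}"
    have "\<epsilon> * real n \<le> real (card {p. \<forall>\<mu>. stable n PW PM \<mu> \<longrightarrow> p \<in> \<mu>})"
      using n stable_meet[OF ij(3,1,2)] by (simp add: card_graph_of)
    then show "\<epsilon> * real n \<le> real (card {p. \<forall>\<mu>. stable n PW PM \<mu> \<longrightarrow> p \<in> \<mu>}) \<and>
        (\<forall>S. finite S \<and> real (card S) \<ge> \<epsilon> * real n
           \<and> (\<forall>p\<in>S. \<forall>\<mu>. stable n PW PM \<mu> \<longrightarrow> p \<in> \<mu>) \<longrightarrow> \<not> \<epsilon> * real n \<le> real (card (S \<inter> diagonal n)))"
      using k(2) card_inter_diagonal[OF ij(1,2)] stable_meet[OF ij(3,1,2)]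
      by (fastforce simp: subset_eq)
  }
qed (use assms in auto)

theorem theorem13:
  shows
   \<comment> \<open>(a) finding a (1-eps)-stable marriage, 0 <= eps < 1/2\<close>
   "(\<forall>\<epsilon>::real. 0 \<le> \<epsilon> \<and> \<epsilon> < 1/2 \<longrightarrow>
      query_lower_bound_sq
        (\<lambda>n (x::unit) pW pM. True)
        (\<lambda>n x pW pM \<mu>. perfect n \<mu> \<and> almost_stable \<epsilon> n pW pM \<mu>))
  \<and> \<comment> \<open>(b) stable vs eps-unstable for a given perfect marriage, 0 <= eps < 1\<close>
   (\<forall>\<epsilon>::real. 0 \<le> \<epsilon> \<and> \<epsilon> < 1 \<longrightarrow>
      query_lower_bound_sq
        (\<lambda>n \<mu> pW pM. perfect n \<mu> \<and> (stable n pW pM \<mu> \<or> eps_unstable \<epsilon> n pW pM \<mu>))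
        (\<lambda>n \<mu> pW pM b. b = stable n pW pM \<mu>))
  \<and> \<comment> \<open>(c) is a given pair in some stable marriage\<close>
   query_lower_bound_sq
        (\<lambda>n (w, m) pW pM. w < n \<and> m < n)
        (\<lambda>n (w, m) pW pM b. b = (\<exists>\<mu>. stable n pW pM \<mu> \<and> (w, m) \<in> \<mu>))
  \<and> \<comment> \<open>(c) is a given pair in every stable marriage\<close>
   query_lower_bound_sq
        (\<lambda>n (w, m) pW pM. w < n \<and> m < n)
        (\<lambda>n (w, m) pW pM b. b = (\<forall>\<mu>. stable n pW pM \<mu> \<longrightarrow> (w, m) \<in> \<mu>))
  \<and> \<comment> \<open>(d) find eps*n pairs each in some stable marriage, 0 < eps <= 1\<close>
   (\<forall>\<epsilon>::real. 0 < \<epsilon> \<and> \<epsilon> \<le> 1 \<longrightarrow>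
      query_lower_bound_sq
        (\<lambda>n (x::unit) pW pM. True)
        (\<lambda>n x pW pM S. finite S \<and> real (card S) \<ge> \<epsilon> * real n
           \<and> (\<forall>p\<in>S. \<exists>\<mu>. stable n pW pM \<mu> \<and> p \<in> \<mu>)))
  \<and> \<comment> \<open>(d) find eps*n pairs each in every stable marriage (promise: enough such pairs exist)\<close>
   (\<forall>\<epsilon>::real. 0 < \<epsilon> \<and> \<epsilon> \<le> 1 \<longrightarrow>
      query_lower_bound_sq
        (\<lambda>n (x::unit) pW pM.
           real (card {p. \<forall>\<mu>. stable n pW pM \<mu> \<longrightarrow> p \<in> \<mu>}) \<ge> \<epsilon> * real n)
        (\<lambda>n x pW pM S. finite S \<and> real (card S) \<ge> \<epsilon> * real n
           \<and> (\<forall>p\<in>S. \<forall>\<mu>. stable n pW pM \<mu> \<longrightarrow> p \<in> \<mu>)))"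
  by (intro conjI allI impI; (elim conjE)?)
    (rule find_almost_stable_lower_bound verify_stable_lower_bound pair_in_some_lower_bound
      pair_in_every_lower_bound find_pairs_in_some_lower_bound find_pairs_in_every_lower_bound; assumption)+

end
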